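(* In each of the two settings described in the context, the temporal distance function $\varphi$ satisfies the local non-integrability condition (LNIC): there exist $\alpha,\beta\in\Sigma$, $k\in\mathcal A$ with $(k,\alpha)$ and $(k,\beta)$ admissible, and $u_0,u_0'\in\Lambda\cap D_k$ such that $\nabla\varphi_{\alpha,\beta,u_0'}(u_0)\ne0$.
   Context: $\mathbb N=\{1,2,\dots\}$. Upper half space model: $\mathbb H^n=\{x\in\mathbb R^n:x_n>0\}$, boundary $\mathbb R^{n-1}\cup\{\infty\}$, $o=e_n$. Schottky semigroup setting. $n\ge2$; $\mathbf G=\mathrm{SO}_Q<\mathrm{GL}_{n+1}$ over $\mathbb Q$ preserves $Q=x_1^2+\dots+x_n^2-x_{n+1}^2$; $G=\mathbf G(\mathbb R)^\circ$ is the group of orientation preserving isometries of $\mathbb H^n$. $N_0\in\mathbb N$, $0\le N_1\le N_0$, $N=N_0+N_1$, $D_1,\dots,D_{2N_0}\subset\mathbb R^{n-1}$ are mutually disjoint closed Euclidean balls; $\Gamma<G$ is a Zariski dense semigroup generated by hyperbolic elements $g_1,\dots,g_N$ with $g_j(\operatorname{ext}(D_{j+N_0}))=\operatorname{int}(D_j)$ for $1\le j\le N_0$ and $g_{N_0+j}=g_j^{-1}$ for $1\le j\le N_1$. (The paper also assumes that the $g_j$ lift to integral points of the simply connected cover of $\mathbf G$.) Continued fractions semigroup setting. $n=3$, $G=\mathrm{SL}_2(\mathbb C)$; $\mathsf A\subset\mathbb N+i\mathbb Z$ finite, $\mathsf A\not\subset\mathbb N$; $g_a=\begin{pmatrix}0&1\\1&a\end{pmatrix}$,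 $g_{a,a'}=g_ag_{a'}$. $\Gamma<G$ is the semigroup generated by $\{g_{a,a'}:a,a'\in\mathsf A\}$, assumed Zariski dense. For $\varepsilon\in(0,\sqrt3-1)$ let $D^\varepsilon=\{\xi\in\mathbb C:\Re\xi\ge\varepsilon,\ |\xi-(2+\varepsilon)^{-1}|\le(2+\varepsilon)^{-1}\}$; fix $\varepsilon$ such that the sets $g_aD^\varepsilon$ ($a\in\mathsf A$) are mutually disjoint and contained in $\operatorname{int}(D^\varepsilon)$. With $N=(\#\mathsf A)^2$, relabel the generators $g_{a,a'}$ as $g_1,\dots,g_N$ and the sets $g_{a,a'}D^\varepsilon$ correspondingly as $D_1,\dots,D_N$. Dynamics. $D=\bigcup_{j=1}^ND_j$; $T(u)=g_j^{-1}u$ for $u\in D_j$. $\mathcal A=\{1,\dots,N\}$. A sequence in $\mathcal A$ is admissible if consecutive entries satisfy $|\alpha_{j+1}-\alpha_j|\ne N_0$ (Schottky), resp. always (continued fractions); $\Sigma$ is the set of infinite admissible sequences $(\alpha_0,\alpha_1,\dots)$. $\Lambda\subset\mathbb R^{n-1}$ is the limit set of $\Gamma$ (limit points of $\Gamma o$ at infinity). The distortion function $\tau:T^{-1}(D)\to\mathbb R$ is $\tau(u)=\log\|d(J\circ T\circ J^{-1})_{J(u)}\|_{\mathrm{op}}$, where $J$ is a conformal map from the upper half space model to the ball model of $\overline{\mathbb H^n}$ taking $o$ to the center. Temporal distance function. For $\alpha\in\Sigma$ and $k\in\mathcal A$ with $(k,\alpha)$ admissible, $\Delta_\alpha\in C^1(D_k\times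 D_k,\mathbb R)$ is $$\Delta_\alpha(u,u')=\sum_{j=0}^\infty\bigl(\tau(g_{\alpha_j}g_{\alpha_{j-1}}\cdots g_{\alpha_0}u)-\tau(g_{\alpha_j}g_{\alpha_{j-1}}\cdots g_{\alpha_0}u')\bigr).$$ For $\alpha,\beta\in\Sigma$ and $k\in\mathcal A$ with $(k,\alpha),(k,\beta)$ admissible, $\varphi_{\alpha,\beta,u'}(u)=\varphi_{\alpha,\beta}(u,u')=\Delta_\alpha(u,u')-\Delta_\beta(u,u')$ for $u,u'\in D_k$; $\nabla$ is the Euclidean gradient in $u$. *)

theory Defs
  imports "HOL-Analysis.Analysis"
begin

section \<open>The closed upper half space and the ball model\<close>

text \<open>With \<open>'a\<close> a Euclidean space of dimension \<open>n - 1\<close>, the closure of \<open>H^n\<close> is modelled by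
  \<open>('a \<times> real) option\<close>: \<open>Some (x, y)\<close> with \<open>y > 0\<close> is the point \<open>(x, y)\<close> of \<open>H^n\<close>,
  \<open>Some (x, 0)\<close> is the boundary point \<open>x\<close>, and \<open>None\<close> is the boundary point \<open>\<infinity>\<close>
  (\<open>Some (x, y)\<close> with \<open>y < 0\<close> is junk).\<close>

type_synonym 'a hpt = "('a \<times> real) option"

definition base_pt :: "'a::euclidean_space hpt" where
  "base_pt = Some (0, 1)"

definition bdry :: "'a::euclidean_space \<Rightarrow> 'a hpt" where
  "bdry x = Some (x, 0)"

definition boundary :: "'a::euclidean_space hpt set" where
  "boundary = insert None (range bdry)"

text \<open>A conformal map from the upper half space model to the unit ball, with \<open>o\<close> going to the
  centre; on the boundary it is the inverse stereographic projection. Any other choice differs from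
  this one by a linear isometry, which does not affect the distortion function below.\<close>

definition to_ball :: "'a::euclidean_space hpt \<Rightarrow> 'a \<times> real" where
  "to_ball p = (case p of
      None \<Rightarrow> (0, 1)
    | Some (x, y) \<Rightarrow>
        (1 / ((norm x)\<^sup>2 + (y + 1)\<^sup>2)) *\<^sub>R (2 *\<^sub>R x, (norm x)\<^sup>2 + y\<^sup>2 - 1))"


section \<open>Semigroups of matrices and Zariski density\<close>

inductive_set semigroup_generated :: "('k::semiring_1^'d^'d) set \<Rightarrow> ('k^'d^'d) set"
  for S where
  generator: "A \<in> S \<Longrightarrow> A \<in> semigroup_generated S"
| product: "A \<in> semigroup_generated S \<Longrightarrow> B \<in> semigroup_generated S
    \<Longrightarrow> A ** B \<in> semigroup_generated S"

inductive entry_polynomial :: "('k::comm_ring_1^'d^'d \<Rightarrow> 'k) \<Rightarrow> bool" where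
  const: "entry_polynomial (\<lambda>_. c)"
| entry: "entry_polynomial (\<lambda>A. A $ i $ j)"
| add: "entry_polynomial f \<Longrightarrow> entry_polynomial h \<Longrightarrow> entry_polynomial (\<lambda>A. f A + h A)"
| mult: "entry_polynomial f \<Longrightarrow> entry_polynomial h \<Longrightarrow> entry_polynomial (\<lambda>A. f A * h A)"

definition zariski_dense_in :: "('k::comm_ring_1^'d^'d) set \<Rightarrow> ('k^'d^'d) set \<Rightarrow> bool" where
  "zariski_dense_in \<Gamma> G \<longleftrightarrow> \<Gamma> \<subseteq> G \<and>
     (\<forall>f. entry_polynomial f \<longrightarrow> (\<forall>A\<in>\<Gamma>. f A = 0) \<longrightarrow> (\<forall>A\<in>G. f A = 0))"


section \<open>Expanding map, distortion function, temporal distance function\<close>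

text \<open>In this section \<open>act\<close> is the action of the matrix group on the closed half space, \<open>g j\<close> and
  \<open>D j\<close> are the generators and the sets indexed by \<open>j \<in> {1..N}\<close>, and \<open>adm i j\<close> says that \<open>j\<close> may
  follow \<open>i\<close> in an admissible sequence.\<close>

definition limit_set ::
    "('k^'d^'d \<Rightarrow> 'a hpt \<Rightarrow> 'a::euclidean_space hpt) \<Rightarrow> ('k^'d^'d) set \<Rightarrow> 'a set" where
  "limit_set act \<Gamma> = {\<xi>. (\<xi>, 0) islimpt {q. \<exists>A\<in>\<Gamma>. act A base_pt = Some q}}"

definition expanding_map ::
    "('k::semiring_1^'d^'d \<Rightarrow> 'a hpt \<Rightarrow> 'a::euclidean_space hpt) \<Rightarrow> (nat \<Rightarrow> 'k^'d^'d)
      \<Rightarrow> (nat \<Rightarrow> 'a set) \<Rightarrow> nat \<Rightarrow> 'a hpt \<Rightarrow> 'a hpt" where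
  "expanding_map act g D N p =
     act (matrix_inv (g (THE j. j \<in> {1..N} \<and> p \<in> bdry ` D j))) p"

text \<open>For \<open>T = expanding_map act g D N\<close>, the map \<open>J \<circ> T \<circ> J\<^sup>-\<^sup>1\<close> lives on the unit sphere, so its
  differential is defined on the tangent space at \<open>J p\<close>, the orthogonal complement of \<open>J p\<close>. The
  Frechet derivative within the sphere is unique only there, and the operator norm is the supremum
  over the unit vectors of that space.\<close>

definition distortion ::
    "('k::semiring_1^'d^'d \<Rightarrow> 'a hpt \<Rightarrow> 'a::euclidean_space hpt) \<Rightarrow> (nat \<Rightarrow> 'k^'d^'d)
      \<Rightarrow> (nat \<Rightarrow> 'a set) \<Rightarrow> nat \<Rightarrow> 'a hpt \<Rightarrow> real" where
  "distortion act g D N p =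
     ln (SUP v \<in> {v. v \<bullet> to_ball p = 0 \<and> norm v = 1}.
           norm (frechet_derivative
                   (to_ball \<circ> expanding_map act g D N \<circ> inv_into boundary to_ball)
                   (at (to_ball p) within sphere 0 1) v))"

definition admissible_seqs :: "nat \<Rightarrow> (nat \<Rightarrow> nat \<Rightarrow> bool) \<Rightarrow> (nat \<Rightarrow> nat) set" where
  "admissible_seqs N adm = {\<alpha>. \<forall>j. \<alpha> j \<in> {1..N} \<and> adm (\<alpha> j) (\<alpha> (Suc j))}"

text \<open>\<open>word g \<alpha> j\<close> is the product \<open>g (\<alpha> j) ** g (\<alpha> (j - 1)) ** \<dots> ** g (\<alpha> 0)\<close>.\<close>

primrec word :: "(nat \<Rightarrow> 'k::semiring_1^'d^'d) \<Rightarrow> (nat \<Rightarrow> nat) \<Rightarrow> nat \<Rightarrow> 'k^'d^'d" where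
  "word g \<alpha> 0 = g (\<alpha> 0)"
| "word g \<alpha> (Suc j) = g (\<alpha> (Suc j)) ** word g \<alpha> j"

definition delta ::
    "('k::semiring_1^'d^'d \<Rightarrow> 'a hpt \<Rightarrow> 'a::euclidean_space hpt) \<Rightarrow> (nat \<Rightarrow> 'k^'d^'d)
      \<Rightarrow> (nat \<Rightarrow> 'a set) \<Rightarrow> nat \<Rightarrow> (nat \<Rightarrow> nat) \<Rightarrow> 'a \<Rightarrow> 'a \<Rightarrow> real" where
  "delta act g D N \<alpha> u u' =
     (\<Sum>j. distortion act g D N (act (word g \<alpha> j) (bdry u))
         - distortion act g D N (act (word g \<alpha> j) (bdry u')))"

definition temporal_distance ::
    "('k::semiring_1^'d^'d \<Rightarrow> 'a hpt \<Rightarrow> 'a::euclidean_space hpt) \<Rightarrow> (nat \<Rightarrow> 'k^'d^'d)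
      \<Rightarrow> (nat \<Rightarrow> 'a set) \<Rightarrow> nat \<Rightarrow> (nat \<Rightarrow> nat) \<Rightarrow> (nat \<Rightarrow> nat) \<Rightarrow> 'a \<Rightarrow> 'a \<Rightarrow> real" where
  "temporal_distance act g D N \<alpha> \<beta> u u' = delta act g D N \<alpha> u u' - delta act g D N \<beta> u u'"

definition LNIC ::
    "('k::semiring_1^'d^'d \<Rightarrow> 'a hpt \<Rightarrow> 'a::euclidean_space hpt) \<Rightarrow> (nat \<Rightarrow> 'k^'d^'d)
      \<Rightarrow> (nat \<Rightarrow> 'a set) \<Rightarrow> nat \<Rightarrow> (nat \<Rightarrow> nat \<Rightarrow> bool) \<Rightarrow> bool" where
  "LNIC act g D N adm \<longleftrightarrow>
     (let \<Lambda> = limit_set act (semigroup_generated (g ` {1..N})) in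
      \<exists>\<alpha> \<in> admissible_seqs N adm. \<exists>\<beta> \<in> admissible_seqs N adm. \<exists>k \<in> {1..N}.
        adm k (\<alpha> 0) \<and> adm k (\<beta> 0) \<and>
        (\<exists>u\<^sub>0 \<in> \<Lambda> \<inter> D k. \<exists>u\<^sub>0' \<in> \<Lambda> \<inter> D k. \<exists>v.
           (GDERIV (\<lambda>u. temporal_distance act g D N \<alpha> \<beta> u u\<^sub>0') u\<^sub>0 :> v) \<and> v \<noteq> 0))"


section \<open>The Schottky semigroup setting\<close>

text \<open>Here \<open>n - 1 = CARD('m)\<close>, and \<open>\<real>\<^sup>n\<^sup>+\<^sup>1\<close> is \<open>real^('m option option)\<close>: the coordinates
  \<open>x\<^sub>1, \<dots>, x\<^sub>n\<^sub>-\<^sub>1\<close> have the indices \<open>Some (Some i)\<close>, the coordinate \<open>x\<^sub>n\<close> has the index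
  \<open>Some None\<close>, and \<open>x\<^sub>n\<^sub>+\<^sub>1\<close> has the index \<open>None\<close>.\<close>

definition quad_form :: "real^('m::finite option option) \<Rightarrow> real" where
  "quad_form x = (\<Sum>i\<in>UNIV. (x $ Some i)\<^sup>2) - (x $ None)\<^sup>2"

definition SO_Q :: "(real^('m::finite option option)^('m option option)) set" where
  "SO_Q = {A. det A = 1 \<and> (\<forall>x. quad_form (A *v x) = quad_form x)}"

definition SO_Q_identity_component :: "(real^('m::finite option option)^('m option option)) set"
  where "SO_Q_identity_component = connected_component_set SO_Q (mat 1)"

text \<open>The closed half space is identified with the projectivization of the cone \<open>Q \<le> 0\<close>. For
  \<open>y > 0\<close> the vector \<open>cone_vector (Some (x, y)) /\<^sub>R (2 * y)\<close> lies on the hyperboloid \<open>Q = -1\<close>, and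
  this is the usual isometry with the hyperboloid model; it takes \<open>o\<close> to the last basis vector. The
  vectors of \<open>Some (x, 0)\<close> and \<open>None\<close> span the isotropic lines.\<close>

definition cone_vector :: "(real^'m::finite) hpt \<Rightarrow> real^('m option option)" where
  "cone_vector p = (case p of
      None \<Rightarrow> (\<chi> i. case i of Some (Some _) \<Rightarrow> 0 | Some None \<Rightarrow> - 1 | None \<Rightarrow> 1)
    | Some (x, y) \<Rightarrow> (\<chi> i. case i of
          Some (Some j) \<Rightarrow> 2 * x $ j
        | Some None \<Rightarrow> 1 - (norm x)\<^sup>2 - y\<^sup>2
        | None \<Rightarrow> 1 + (norm x)\<^sup>2 + y\<^sup>2))"

definition cone_point :: "real^('m::finite option option) \<Rightarrow> (real^'m) hpt" where
  "cone_point w = (let s = w $ Some None + w $ None in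
     if s = 0 then None
     else Some ((\<chi> j. w $ Some (Some j) / s), sqrt (- quad_form w) / s))"

definition act_SO ::
    "real^('m::finite option option)^('m option option) \<Rightarrow> (real^'m) hpt \<Rightarrow> (real^'m) hpt" where
  "act_SO A p = cone_point (A *v cone_vector p)"

definition hyperbolic_element :: "real^('m::finite option option)^('m option option) \<Rightarrow> bool" where
  "hyperbolic_element A \<longleftrightarrow> A \<in> SO_Q_identity_component \<and>
     (\<forall>x y. y > 0 \<longrightarrow> act_SO A (Some (x, y)) \<noteq> Some (x, y)) \<and>
     card {p \<in> boundary. act_SO A p = p} = 2"

text \<open>The exterior of a ball is its complement in the whole boundary, so it contains \<open>\<infinity>\<close>.\<close>

definition schottky_setting ::
    "nat \<Rightarrow> nat \<Rightarrow> (nat \<Rightarrow> real^('m::finite option option)^('m option option))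
      \<Rightarrow> (nat \<Rightarrow> (real^'m) set) \<Rightarrow> bool" where
  "schottky_setting N\<^sub>0 N\<^sub>1 g D \<longleftrightarrow>
     1 \<le> N\<^sub>0 \<and> N\<^sub>1 \<le> N\<^sub>0 \<and>
     (\<forall>j\<in>{1..2 * N\<^sub>0}. \<exists>c r. r > 0 \<and> D j = cball c r) \<and>
     disjoint_family_on D {1..2 * N\<^sub>0} \<and>
     (\<forall>j\<in>{1..N\<^sub>0 + N\<^sub>1}. hyperbolic_element (g j)) \<and>
     (\<forall>j\<in>{1..N\<^sub>0}. act_SO (g j) ` (boundary - bdry ` D (j + N\<^sub>0)) = bdry ` interior (D j)) \<and>
     (\<forall>j\<in>{1..N\<^sub>1}. g (N\<^sub>0 + j) = matrix_inv (g j)) \<and>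
     zariski_dense_in (semigroup_generated (g ` {1..N\<^sub>0 + N\<^sub>1})) SO_Q_identity_component"

definition schottky_adm :: "nat \<Rightarrow> nat \<Rightarrow> nat \<Rightarrow> bool" where
  "schottky_adm N\<^sub>0 i j \<longleftrightarrow> \<bar>int j - int i\<bar> \<noteq> int N\<^sub>0"


section \<open>The continued fractions semigroup setting\<close>

definition SL2C :: "(complex^2^2) set" where
  "SL2C = {A. det A = 1}"

text \<open>The action by linear fractional transformations on the boundary and by their Poincare extension
  on \<open>H^3\<close>. It is written for all invertible matrices, because the matrices \<open>cf_matrix a\<close> below have
  determinant \<open>-1\<close>.\<close>

definition act_SL2 :: "complex^2^2 \<Rightarrow> complex hpt \<Rightarrow> complex hpt" where
  "act_SL2 A p =
    (let a = A $ 1 $ 1; b = A $ 1 $ 2; c = A $ 2 $ 1; d = A $ 2 $ 2 in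
     case p of
       None \<Rightarrow> if c = 0 then None else bdry (a / c)
     | Some (z, t) \<Rightarrow>
         let q = (cmod (c * z + d))\<^sup>2 + (cmod c)\<^sup>2 * t\<^sup>2 in
         if q = 0 then None
         else Some (((a * z + b) * cnj (c * z + d) + a * cnj c * complex_of_real (t\<^sup>2))
                      / complex_of_real q,
                    cmod (det A) * t / q))"

definition cf_matrix :: "complex \<Rightarrow> complex^2^2" where
  "cf_matrix a = vector [vector [0, 1], vector [1, a]]"

definition cf_region :: "real \<Rightarrow> complex set" where
  "cf_region \<epsilon> =
     {\<xi>. Re \<xi> \<ge> \<epsilon> \<and> cmod (\<xi> - complex_of_real (1 / (2 + \<epsilon>))) \<le> 1 / (2 + \<epsilon>)}"

text \<open>The bijection \<open>e\<close> is the relabelling of the pairs \<open>(a, a')\<close> by \<open>1, \<dots>, N\<close>.\<close>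

definition cf_setting ::
    "complex set \<Rightarrow> real \<Rightarrow> (nat \<Rightarrow> complex^2^2) \<Rightarrow> (nat \<Rightarrow> complex set) \<Rightarrow> bool" where
  "cf_setting A \<epsilon> g D \<longleftrightarrow>
     finite A \<and>
     A \<subseteq> {of_nat m + \<i> * of_int l | m l. m \<ge> 1} \<and>
     \<not> A \<subseteq> {of_nat m | m. m \<ge> 1} \<and>
     zariski_dense_in
       (semigroup_generated {cf_matrix a ** cf_matrix a' | a a'. a \<in> A \<and> a' \<in> A}) SL2C \<and>
     0 < \<epsilon> \<and> \<epsilon> < sqrt 3 - 1 \<and>
     disjoint_family_on (\<lambda>a. act_SL2 (cf_matrix a) ` bdry ` cf_region \<epsilon>) A \<and>
     (\<forall>a\<in>A. act_SL2 (cf_matrix a) ` bdry ` cf_region \<epsilon> \<subseteq> bdry ` interior (cf_region \<epsilon>)) \<and>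
     (\<exists>e. bij_betw e {1..(card A)\<^sup>2} (A \<times> A) \<and>
        (\<forall>j\<in>{1..(card A)\<^sup>2}.
           g j = cf_matrix (fst (e j)) ** cf_matrix (snd (e j)) \<and>
           bdry ` D j = act_SL2 (g j) ` bdry ` cf_region \<epsilon>))"

definition cf_adm :: "nat \<Rightarrow> nat \<Rightarrow> bool" where
  "cf_adm i j \<longleftrightarrow> True"

end

theory Submission
  imports Defs
begin

text \<open>Take for \<open>\<alpha>\<close> and \<open>\<beta>\<close> two constant sequences \<open>(a, a, \<dots>)\<close> and \<open>(b, b, \<dots>)\<close>. A generator
  \<open>g\<^sub>a\<close> is loxodromic with attracting fixed point \<open>p\<close> and repelling fixed point \<open>q\<close>. The conformal
  factor of \<open>g\<^sub>a\<close> at \<open>x\<close> is a constant times \<open>(|g\<^sub>a x - q| / |x - q|)\<^sup>2\<close>, because \<open>q\<close> is fixed; hence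
  the series defining \<open>\<Delta>\<^sub>\<alpha>\<close> telescopes, and \<open>\<Delta>\<^sub>\<alpha>(u, u') = k(u) - k(u')\<close> with
  \<open>k(u) = 2 log |u - q| - log (1 + |u|\<^sup>2)\<close>. If \<open>q'\<close> is the repelling fixed point of \<open>g\<^sub>b\<close>, the gradient of
  \<open>\<phi>\<close> is therefore twice the difference of the inversions of \<open>u\<close> at \<open>q\<close> and \<open>q'\<close>, which vanishes only
  for \<open>q = q'\<close>. Zariski density is used only to obtain two such generators: a commutative
  semigroup is not dense. For \<open>u\<^sub>0 = u\<^sub>0'\<close> take the attracting fixed point of \<open>g\<^sub>a\<close>, which is a limit
  of the orbit of \<open>o\<close>.\<close>

section \<open>The distortion function in Euclidean coordinates\<close>

text \<open>The distortion is built from a choice-based Frechet derivative within the sphere, so its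
  value has to be computed before anything can telescope. No derivative formula for a Moebius map is
  used: each map f that occurs satisfies |f y - f x|^2 = m(y) m(x) |y - x|^2 with m continuous,
  which forces |f'(x) v| = m(x) |v|. Putting x = q, a fixed point, expresses m through distances to
  q. A gradient needs the closed formula for both \<Delta> functions on a whole neighbourhood of
  u_0. Hence each generator carries an open set U that is stable under it and avoids its repelling
  point, and the set for b must contain the attracting point of a. The repelling points differ for
  separate reasons. For continued fractions the generators are g_{a,a}, and q determines a through q
  (q + a) = 1. For Schottky semigroups the repelling points lie in the disjoint balls D_{1+N_0} and
  D_{2+N_0}; the indices 1 and 2 are admissible in every order needed once N_0 \<ge> 2.\<close>

definition stereo :: "'a::euclidean_space \<Rightarrow> 'a \<times> real" where
  "stereo x = to_ball (bdry x)"

lemma stereo_eq: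
  "stereo x = ((2 / (1 + (norm x)\<^sup>2)) *\<^sub>R x, ((norm x)\<^sup>2 - 1) / (1 + (norm x)\<^sup>2))"
  by (simp add: stereo_def to_ball_def bdry_def add.commute)

lemma one_plus_norm_pos [simp]: "1 + (norm x)\<^sup>2 > 0" "1 + (norm x)\<^sup>2 \<noteq> 0"
  by (smt (verit) zero_le_power2)+

lemma stereo_inner:
  "stereo x \<bullet> stereo y
    = (4 * (x \<bullet> y) + ((norm x)\<^sup>2 - 1) * ((norm y)\<^sup>2 - 1)) / ((1 + (norm x)\<^sup>2) * (1 + (norm y)\<^sup>2))"
  by (simp add: stereo_eq add_divide_distrib)

lemma norm_stereo [simp]: "norm (stereo x) = 1"
proof -
  have *: "4 * (x \<bullet> x) + ((norm x)\<^sup>2 - 1) * ((norm x)\<^sup>2 - 1) = (1 + (norm x)\<^sup>2) * (1 + (norm x)\<^sup>2)"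
    by (simp add: power2_norm_eq_inner algebra_simps)
  show ?thesis unfolding norm_eq_1 stereo_inner * by simp
qed

text \<open>This is the two-point identity with m(x) = 2 / (1 + |x|^2), the model for all
  conformality statements below.\<close>

lemma dist_stereo:
  "(norm (stereo x - stereo y))\<^sup>2
    = (2 / (1 + (norm x)\<^sup>2)) * (2 / (1 + (norm y)\<^sup>2)) * (norm (x - y))\<^sup>2"
proof -
  have "(norm (stereo x - stereo y))\<^sup>2 = 2 - 2 * (stereo x \<bullet> stereo y)"
    using norm_stereo[of x] norm_stereo[of y] unfolding norm_eq_1
    by (simp add: power2_norm_eq_inner inner_diff inner_commute)
  also have "\<dots> = (2 * ((1 + (norm x)\<^sup>2) * (1 + (norm y)\<^sup>2))
       - 2 * (4 * (x \<bullet> y) + ((norm x)\<^sup>2 - 1) * ((norm y)\<^sup>2 - 1)))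
      / ((1 + (norm x)\<^sup>2) * (1 + (norm y)\<^sup>2))"
    by (simp add: stereo_inner diff_divide_distrib)
  also have "2 * ((1 + (norm x)\<^sup>2) * (1 + (norm y)\<^sup>2))
       - 2 * (4 * (x \<bullet> y) + ((norm x)\<^sup>2 - 1) * ((norm y)\<^sup>2 - 1)) = 4 * (norm (x - y))\<^sup>2"
    by (simp add: power2_norm_eq_inner inner_diff inner_commute algebra_simps)
  finally show ?thesis by simp
qed

text \<open>Central projection from the pole (0, 1), the image of \<infinity>. The formula also
  makes sense off the sphere, so it has an ordinary derivative in the ambient space.\<close>

definition unstereo :: "'a::euclidean_space \<times> real \<Rightarrow> 'a" where
  "unstereo w = (1 / (1 - snd w)) *\<^sub>R fst w"

lemma unstereo_stereo [simp]: "unstereo (stereo x) = x"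
proof -
  have "1 - ((norm x)\<^sup>2 - 1) / (1 + (norm x)\<^sup>2) = 2 / (1 + (norm x)\<^sup>2)"
    by (simp add: field_simps)
  then have "unstereo (stereo x) = ((1 / (2 / (1 + (norm x)\<^sup>2))) * (2 / (1 + (norm x)\<^sup>2))) *\<^sub>R x"
    by (simp only: unstereo_def stereo_eq fst_conv snd_conv scaleR_scaleR)
  then show ?thesis using one_plus_norm_pos(2)[of x]
    by (metis (no_types) divide_divide_eq_right divide_self mult_1 nonzero_mult_div_cancel_left scaleR_one
        times_divide_eq_left times_divide_eq_right zero_neq_numeral divide_eq_0_iff mult.commute
        nonzero_eq_divide_eq)
qed

lemma snd_stereo_neq_1: "snd (stereo x) \<noteq> 1"
  by (simp add: stereo_eq divide_eq_eq)

lemma stereo_unstereo: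
  assumes "norm w = 1" "snd w \<noteq> 1"
  shows "stereo (unstereo w) = w"
proof -
  obtain X Z where w: "w = (X, Z)" by fastforce
  have X2: "(norm X)\<^sup>2 = 1 - Z\<^sup>2" using assms(1) unfolding w norm_Pair
    by (simp add: real_sqrt_eq_1_iff)
  have Z: "Z \<noteq> 1" using assms(2) w by simp
  have n: "(norm (unstereo w))\<^sup>2 = (1 + Z) / (1 - Z)"
  proof -
    have "(norm (unstereo w))\<^sup>2 = (norm X)\<^sup>2 / (1 - Z)\<^sup>2"
      by (simp add: unstereo_def w power_divide)
    also have "1 - Z\<^sup>2 = (1 + Z) * (1 - Z)"
      by (simp add: power2_eq_square algebra_simps)
    note X2[unfolded this]
    also have "(1 + Z) * (1 - Z) / (1 - Z)\<^sup>2 = ((1 + Z) * (1 - Z)) / ((1 - Z) * (1 - Z))"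
      by (simp add: power2_eq_square)
    finally show ?thesis using Z by simp
  qed
  have a: "1 + (1 + Z) / (1 - Z) = 2 / (1 - Z)" "(1 + Z) / (1 - Z) - 1 = 2 * Z / (1 - Z)"
    using Z by (simp_all add: field_simps)
  show ?thesis
    unfolding stereo_eq n a using Z by (simp add: w unstereo_def)
qed

text \<open>Needed to evaluate \<open>inv_into boundary to_ball\<close> in the distortion. The point
  \<open>None\<close> goes to the pole, which \<open>stereo\<close> misses.\<close>

lemma inj_on_to_ball: "inj_on to_ball (boundary :: 'a::euclidean_space hpt set)"
proof -
  have n: "snd (to_ball (None :: 'a hpt)) = 1" by (simp add: to_ball_def)
  have s: "to_ball (bdry x) = stereo x" for x :: 'a by (simp add: stereo_def)
  have "p = p'" if pp: "p \<in> boundary" "p' \<in> boundary" "to_ball p = to_ball p'"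
    for p p' :: "'a hpt"
  proof (cases "p = None \<or> p' = None")
    case True
    then show ?thesis using that n s snd_stereo_neq_1 unfolding boundary_def
      by (metis (no_types) imageE insertE)
  next
    case False
    then obtain x x' where "p = bdry x" "p' = bdry x'" using pp unfolding boundary_def by blast
    then show ?thesis using that(3) s unstereo_stereo by metis
  qed
  then show ?thesis by (rule inj_onI)
qed

lemma inv_into_to_ball:
  assumes "norm w = 1" "snd w \<noteq> 1"
  shows "inv_into boundary to_ball w = bdry (unstereo w)"
  using inv_into_f_f[OF inj_on_to_ball, of "bdry (unstereo w)"] stereo_unstereo[OF assms]
  by (simp add: stereo_def boundary_def)

section \<open>Conformal factors and derivatives within the sphere\<close>

text \<open>Along the ray x + t v the squared difference quotient equals m(x + t v) m(x) |v|^2. As t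
  tends to 0 it converges to |f' v|^2 on one side and to (m(x) |v|)^2 on the other.\<close>

lemma norm_conformal_derivative:
  fixes f :: "'a::real_normed_vector \<Rightarrow> 'b::real_normed_vector"
  assumes f: "(f has_derivative f') (at x)"
    and m: "isCont m x" "m x \<ge> 0"
    and ev: "\<forall>\<^sub>F y in at x. (norm (f y - f x))\<^sup>2 = m y * m x * (norm (y - x))\<^sup>2"
  shows "norm (f' v) = m x * norm v"
proof (cases "v = 0")
  case True
  then show ?thesis using has_derivative_bounded_linear[OF f]
    by (simp add: linear_simps)
next
  case False
  interpret bounded_linear f' using f by (rule has_derivative_bounded_linear)
  have l: "((\<lambda>t::real. x + t *\<^sub>R v) \<longlongrightarrow> x) (at 0)"
    by (auto intro!: tendsto_eq_intros)
  have fl: "filterlim (\<lambda>t::real. x + t *\<^sub>R v) (at x) (at 0)"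
    using l False by (auto simp: filterlim_at eventually_at_filter)
  have "((\<lambda>t::real. f (x + t *\<^sub>R v)) has_derivative (\<lambda>t. f' (t *\<^sub>R v))) (at 0)"
    by (rule has_derivative_compose[where g = f, of "\<lambda>t. x + t *\<^sub>R v" "\<lambda>t. t *\<^sub>R v"])
      (use f in \<open>auto intro!: derivative_eq_intros\<close>)
  then have "((\<lambda>t::real. f (x + t *\<^sub>R v)) has_vector_derivative f' v) (at 0)"
    by (simp add: has_vector_derivative_def scaleR)
  then have "((\<lambda>t::real. norm (f (x + t *\<^sub>R v) - f x - t *\<^sub>R f' v) / norm t) \<longlongrightarrow> 0) (at 0)"
    by (simp add: has_vector_derivative_def has_derivative_at)
  then have "((\<lambda>t::real. norm ((1 / t) *\<^sub>R (f (x + t *\<^sub>R v) - f x) - f' v)) \<longlongrightarrow> 0) (at 0)"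
  proof (rule Lim_transform_eventually)
    have "norm (f (x + t *\<^sub>R v) - f x - t *\<^sub>R f' v) / norm t
        = norm ((1 / t) *\<^sub>R (f (x + t *\<^sub>R v) - f x) - f' v)" if "t \<noteq> 0" for t
    proof -
      have "(1 / t) *\<^sub>R (f (x + t *\<^sub>R v) - f x) - f' v
          = (1 / t) *\<^sub>R (f (x + t *\<^sub>R v) - f x - t *\<^sub>R f' v)"
        using that by (simp add: scaleR_diff_right)
      then show ?thesis by simp
    qed
    then show "\<forall>\<^sub>F t in at 0. norm (f (x + t *\<^sub>R v) - f x - t *\<^sub>R f' v) / norm t
        = norm ((1 / t) *\<^sub>R (f (x + t *\<^sub>R v) - f x) - f' v)"
      by (auto simp: eventually_at_filter)
  qed
  then have "((\<lambda>t::real. (1 / t) *\<^sub>R (f (x + t *\<^sub>R v) - f x)) \<longlongrightarrow> f' v) (at 0)"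
    by (simp add: tendsto_norm_zero_iff LIM_zero_iff)
  then have "((\<lambda>t::real. (norm ((1 / t) *\<^sub>R (f (x + t *\<^sub>R v) - f x)))\<^sup>2) \<longlongrightarrow> (norm (f' v))\<^sup>2) (at 0)"
    by (intro tendsto_intros)
  moreover have "((\<lambda>t::real. (norm ((1 / t) *\<^sub>R (f (x + t *\<^sub>R v) - f x)))\<^sup>2)
      \<longlongrightarrow> m x * m x * (norm v)\<^sup>2) (at 0)"
  proof (rule Lim_transform_eventually)
    show "((\<lambda>t. m (x + t *\<^sub>R v) * m x * (norm v)\<^sup>2) \<longlongrightarrow> m x * m x * (norm v)\<^sup>2) (at 0)"
      by (intro tendsto_intros isCont_tendsto_compose[OF m(1)] l)
    show "\<forall>\<^sub>F t in at 0. m (x + t *\<^sub>R v) * m x * (norm v)\<^sup>2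
        = (norm ((1 / t) *\<^sub>R (f (x + t *\<^sub>R v) - f x)))\<^sup>2"
      using eventually_compose_filterlim[OF ev fl] eventually_neq_at_within[of 0]
      by eventually_elim (simp add: power_divide power_mult_distrib)
  qed
  ultimately have "(norm (f' v))\<^sup>2 = m x * m x * (norm v)\<^sup>2"
    by (rule tendsto_unique[rotated]) simp
  then have "(norm (f' v))\<^sup>2 = (m x * norm v)\<^sup>2" by (simp add: power2_eq_square)
  then show ?thesis using m(2) by (simp add: power2_eq_iff_nonneg)
qed

text \<open>Derivatives within the sphere may differ in the normal direction. On a tangent vector v
  both are the velocity of f along the great circle \<gamma> through P with initial velocity
  v.\<close>

lemma sphere_derivative_unique:
  fixes f :: "'a::euclidean_space \<Rightarrow> 'b::real_normed_vector"
  assumes f1: "(f has_derivative f1) (at P within sphere 0 1)"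
    and f2: "(f has_derivative f2) (at P within sphere 0 1)"
    and P: "norm P = 1" and v: "norm v = 1" "v \<bullet> P = 0"
  shows "f1 v = f2 v"
proof -
  define \<gamma> where "\<gamma> = (\<lambda>t::real. cos t *\<^sub>R P + sin t *\<^sub>R v)"
  have "norm (\<gamma> t) = 1" for t
  proof -
    have "\<gamma> t \<bullet> \<gamma> t = (cos t)\<^sup>2 + (sin t)\<^sup>2"
      using P v by (simp add: \<gamma>_def inner_add inner_commute norm_eq_1 power2_eq_square)
    then show ?thesis by (simp add: norm_eq_1)
  qed
  then have sub: "range \<gamma> \<subseteq> sphere 0 1" by auto
  have \<gamma>: "(\<gamma> has_derivative (\<lambda>t. t *\<^sub>R v)) (at 0)"
    unfolding \<gamma>_def by (auto intro!: derivative_eq_intros)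
  have \<gamma>0: "\<gamma> 0 = P" by (simp add: \<gamma>_def)
  have c: "((\<lambda>t. f (\<gamma> t)) has_vector_derivative f' v) (at 0)"
    if "(f has_derivative f') (at P within sphere 0 1)" for f'
  proof -
    have "((\<lambda>t. f (\<gamma> t)) has_derivative (\<lambda>t. f' (t *\<^sub>R v))) (at 0)"
      by (rule has_derivative_in_compose[OF \<gamma>])
        (use that has_derivative_subset sub \<gamma>0 in auto)
    moreover have "f' (t *\<^sub>R v) = t *\<^sub>R f' v" for t
      using has_derivative_bounded_linear[OF that] by (simp add: linear_simps)
    ultimately show ?thesis by (simp add: has_vector_derivative_def)
  qed
  show ?thesis using c[OF f1] c[OF f2] by (rule vector_derivative_unique_at)
qed

lemma stereo_derivative:
  obtains \<sigma>' where "(stereo has_derivative \<sigma>') (at x)"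
    "\<And>v. norm (\<sigma>' v) = 2 / (1 + (norm x)\<^sup>2) * norm v"
proof -
  have e: "stereo = (\<lambda>x::'a. ((2 / (1 + x \<bullet> x)) *\<^sub>R x, (x \<bullet> x - 1) / (1 + x \<bullet> x)))"
    by (auto simp: stereo_eq power2_norm_eq_inner)
  have "1 + x \<bullet> x \<noteq> 0"
    using one_plus_norm_pos(2)[of x] by (simp add: power2_norm_eq_inner)
  then have "stereo differentiable (at x)" unfolding e
    by (auto intro!: derivative_intros differentiable_Pair simp: differentiable_def)
      (auto intro!: exI derivative_eq_intros)
  then obtain \<sigma>' where \<sigma>': "(stereo has_derivative \<sigma>') (at x)"
    by (auto simp: differentiable_def)
  have "norm (\<sigma>' v) = 2 / (1 + (norm x)\<^sup>2) * norm v" for v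
    by (rule norm_conformal_derivative[OF \<sigma>', of "\<lambda>y. 2 / (1 + (norm y)\<^sup>2)"])
      (auto simp: dist_stereo intro!: continuous_intros)
  with \<sigma>' that show thesis by blast
qed

text \<open>Near P the conjugated map is \<open>stereo\<close> after \<psi> after
  \<open>unstereo\<close>. Unit tangent vectors are scaled successively by (1 + |x|^2) / 2, by m and
  by 2 / (1 + |\<psi> x|^2), so the supremum is that of a constant.\<close>

lemma distortion_eq:
  fixes \<psi> :: "'a::euclidean_space \<Rightarrow> 'a"
  assumes T: "\<forall>\<^sub>F y in nhds x. expanding_map act g D N (bdry y) = bdry (\<psi> y)"
    and \<psi>: "(\<psi> has_derivative \<psi>') (at x)" and m: "\<And>v. norm (\<psi>' v) = m * norm v"
  shows "distortion act g D N (bdry x) = ln (m * (1 + (norm x)\<^sup>2) / (1 + (norm (\<psi> x))\<^sup>2))"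
proof -
  define P where "P = stereo x"
  define f where "f = to_ball \<circ> expanding_map act g D N \<circ> inv_into boundary to_ball"
  have P: "norm P = 1" "snd P \<noteq> 1" "unstereo P = x"
    using snd_stereo_neq_1[of x] by (auto simp: P_def)
  obtain \<rho>' where \<rho>': "(unstereo has_derivative \<rho>') (at P)"
  proof -
    have "unstereo differentiable (at P)"
      unfolding unstereo_def[abs_def] differentiable_def
      using P(2) by (auto intro!: exI derivative_eq_intros)
    with that show thesis by (auto simp: differentiable_def)
  qed
  obtain \<sigma>1 where \<sigma>1: "(stereo has_derivative \<sigma>1) (at x)"
      "\<And>v. norm (\<sigma>1 v) = 2 / (1 + (norm x)\<^sup>2) * norm v"
    using stereo_derivative by blast
  obtain \<sigma>2 where \<sigma>2: "(stereo has_derivative \<sigma>2) (at (\<psi> x))"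
      "\<And>v. norm (\<sigma>2 v) = 2 / (1 + (norm (\<psi> x))\<^sup>2) * norm v"
    using stereo_derivative by blast
  have ev1: "\<forall>\<^sub>F w in at P within sphere 0 1. norm w = 1 \<and> snd w \<noteq> 1"
  proof -
    have "\<forall>\<^sub>F w in nhds P. snd w \<noteq> 1"
      by (rule t1_space_nhds[THEN eventually_compose_filterlim])
        (use P(2) in \<open>auto intro!: filterlim_ident tendsto_intros\<close>)
    then show ?thesis unfolding eventually_at_filter by eventually_elim auto
  qed
  have ev2: "\<forall>\<^sub>F w in at P within sphere 0 1.
      expanding_map act g D N (bdry (unstereo w)) = bdry (\<psi> (unstereo w))"
  proof -
    have "isCont unstereo P" using \<rho>' by (rule has_derivative_continuous)
    then have "filterlim unstereo (nhds x) (at P within sphere 0 1)"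
      using P(3) by (metis isCont_def tendsto_within_subset subset_UNIV)
    then show ?thesis by (rule eventually_compose_filterlim[OF T])
  qed
  \<comment> \<open>\<open>unstereo\<close> scales uniformly only along the sphere. Its factor there
    is the reciprocal of that of \<open>stereo\<close>, because the composition is the identity on
    the sphere and derivatives agree on tangent vectors.\<close>
  have nrm: "norm (\<rho>' v) = (1 + (norm x)\<^sup>2) / 2" if v: "v \<bullet> P = 0" "norm v = 1" for v
  proof -
    have "((\<lambda>w. stereo (unstereo w)) has_derivative (\<lambda>v. \<sigma>1 (\<rho>' v))) (at P within sphere 0 1)"
      using has_derivative_compose[OF \<rho>', of stereo \<sigma>1] \<sigma>1(1) P(3)
      by (simp add: has_derivative_at_withinI)
    then have "((\<lambda>w. w) has_derivative (\<lambda>v. \<sigma>1 (\<rho>' v))) (at P within sphere 0 1)"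
      by (rule has_derivative_transform_eventually)
        (use ev1 P in \<open>auto simp: stereo_unstereo elim!: eventually_mono\<close>)
    from sphere_derivative_unique[OF this has_derivative_ident P(1) v(2,1)]
    have "norm (\<sigma>1 (\<rho>' v)) = 1" using v by simp
    then have "2 / (1 + (norm x)\<^sup>2) * norm (\<rho>' v) = 1" unfolding \<sigma>1(2) .
    then show ?thesis by (simp add: field_simps)
  qed
  have f: "(f has_derivative (\<lambda>v. \<sigma>2 (\<psi>' (\<rho>' v)))) (at P within sphere 0 1)"
  proof -
    have "((\<lambda>w. \<psi> (unstereo w)) has_derivative (\<lambda>v. \<psi>' (\<rho>' v))) (at P)"
      using has_derivative_compose[OF \<rho>', of \<psi> \<psi>'] \<psi> P(3) by simp
    from has_derivative_compose[OF this, of stereo \<sigma>2] \<sigma>2(1) P(3)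
    have "((\<lambda>w. stereo (\<psi> (unstereo w))) has_derivative (\<lambda>v. \<sigma>2 (\<psi>' (\<rho>' v)))) (at P within sphere 0 1)"
      by (simp add: has_derivative_at_withinI)
    then show ?thesis
    proof (rule has_derivative_transform_eventually)
      show "\<forall>\<^sub>F w in at P within sphere 0 1. stereo (\<psi> (unstereo w)) = f w"
        using ev1 ev2 by eventually_elim (simp add: f_def inv_into_to_ball stereo_def)
      show "stereo (\<psi> (unstereo P)) = f P"
        using P eventually_nhds_x_imp_x[OF T] by (simp add: f_def inv_into_to_ball stereo_def)
    qed (use P in auto)
  qed
  then have fd: "(f has_derivative frechet_derivative f (at P within sphere 0 1)) (at P within sphere 0 1)"
    using frechet_derivative_works differentiable_def by blast
  have eq: "norm (frechet_derivative f (at P within sphere 0 1) v)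
      = m * (1 + (norm x)\<^sup>2) / (1 + (norm (\<psi> x))\<^sup>2)"
    if v: "v \<bullet> P = 0" "norm v = 1" for v
    unfolding sphere_derivative_unique[OF fd f P(1) v(2,1)] \<sigma>2(2) m nrm[OF v]
  proof -
    have "2 / b * (m * (a / 2)) = m * a / b" for a b :: real by simp
    then show "2 / (1 + (norm (\<psi> x))\<^sup>2) * (m * ((1 + (norm x)\<^sup>2) / 2))
      = m * (1 + (norm x)\<^sup>2) / (1 + (norm (\<psi> x))\<^sup>2)" .
  qed
  \<comment> \<open>The tangent space contains a unit vector because the ambient dimension is at
    least 2; otherwise the supremum would be over the empty set.\<close>
  have "\<exists>v. v \<bullet> P = 0 \<and> norm v = 1"
  proof -
    have "2 \<le> DIM('a \<times> real)" using DIM_positive[where 'a='a] by simp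
    from orthogonal_to_vector_exists[OF this, of P] obtain y where y: "y \<noteq> 0" "orthogonal P y" by blast
    then show ?thesis
      by (intro exI[of _ "(1 / norm y) *\<^sub>R y"]) (simp add: orthogonal_def inner_commute)
  qed
  then have ne: "{v. v \<bullet> P = 0 \<and> norm v = 1} \<noteq> {}" by auto
  have "(SUP v \<in> {v. v \<bullet> P = 0 \<and> norm v = 1}.
          norm (frechet_derivative f (at P within sphere 0 1) v))
      = (SUP v \<in> {v. v \<bullet> P = 0 \<and> norm v = 1}. m * (1 + (norm x)\<^sup>2) / (1 + (norm (\<psi> x))\<^sup>2))"
    by (intro SUP_cong) (auto simp: eq)
  also have "\<dots> = m * (1 + (norm x)\<^sup>2) / (1 + (norm (\<psi> x))\<^sup>2)"
    using ne by (rule cSUP_const)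
  finally show ?thesis
    by (simp add: distortion_def f_def P_def stereo_def)
qed

section \<open>Convergence to the attracting fixed point\<close>

text \<open>The ratio r = |x - p| / |x - q| is multiplied by \<kappa> at each step, so it tends to
  0. Once r < 1/2, the triangle inequality bounds |x - q| by 2 |p - q|, and then |x - p| \<le> 2 r
  |p - q|.\<close>

lemma tendsto_of_ratio_contraction:
  fixes x :: "nat \<Rightarrow> 'a::real_normed_vector"
  assumes \<kappa>: "0 \<le> \<kappa>" "\<kappa> < 1" and pq: "p \<noteq> q" and q: "\<And>n. x n \<noteq> q"
    and step: "\<And>n. norm (x (Suc n) - p) * norm (x n - q) = \<kappa> * norm (x (Suc n) - q) * norm (x n - p)"
  shows "x \<longlonglongrightarrow> p"
proof -
  define r where "r n = norm (x n - p) / norm (x n - q)" for n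
  have q': "norm (x n - q) > 0" for n using q by simp
  have "r (Suc n) = \<kappa> * r n" for n
    using step[of n] q'[of n] q'[of "Suc n"] by (simp add: r_def divide_simps mult_ac)
  then have r: "r n = \<kappa> ^ n * r 0" for n
    by (induction n) auto
  have r0: "r \<longlonglongrightarrow> 0"
  proof -
    have "(\<lambda>n. \<kappa> ^ n * r 0) \<longlonglongrightarrow> 0"
      using \<kappa> by (intro tendsto_mult_left_zero LIMSEQ_power_zero) auto
    moreover have "r = (\<lambda>n. \<kappa> ^ n * r 0)" using r by (rule ext)
    ultimately show ?thesis by argo
  qed
  have "\<forall>\<^sub>F n in sequentially. r n < 1/2"
    using r0 by (rule order_tendstoD) simp
  then have "\<forall>\<^sub>F n in sequentially. norm (x n - p) \<le> r n * (2 * norm (p - q))"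
  proof eventually_elim
    case (elim n)
    have 1: "norm (x n - p) = r n * norm (x n - q)" using q'[of n] by (simp add: r_def)
    also have "\<dots> \<le> 1/2 * norm (x n - q)" using elim by (intro mult_right_mono) auto
    finally have "norm (x n - p) \<le> 1/2 * norm (x n - q)" .
    moreover have "norm (x n - q) \<le> norm (x n - p) + norm (p - q)" using norm_triangle_ineq[of "x n - p" "p - q"] by simp
    ultimately have "norm (x n - q) \<le> 2 * norm (p - q)" by simp
    moreover have "r n \<ge> 0" by (simp add: r_def)
    ultimately show ?case unfolding 1 by (intro mult_left_mono)
  qed
  moreover have "(\<lambda>n. r n * (2 * norm (p - q))) \<longlonglongrightarrow> 0"
    using r0 by (rule tendsto_mult_left_zero)
  ultimately have "(\<lambda>n. x n - p) \<longlonglongrightarrow> 0"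
    by (rule Lim_null_comparison)
  then show ?thesis by (simp add: LIM_zero_iff)
qed

section \<open>Two attracting generators imply LNIC\<close>

text \<open>The common interface of both settings: \<phi> is the boundary action of
  \<open>g a\<close> on U. The distortion is prescribed at \<open>\<phi> x\<close>, since every term
  of \<open>delta\<close> is evaluated at an image point. U need not contain p; in the application
  to b it has to contain the attracting point of the other generator.\<close>

locale attracting_generator =
  fixes act :: "'k::semiring_1^'d^'d \<Rightarrow> 'a hpt \<Rightarrow> 'a::euclidean_space hpt"
    and g :: "nat \<Rightarrow> 'k^'d^'d" and D :: "nat \<Rightarrow> 'a set" and N a :: nat
    and U :: "'a set" and p q :: 'a and \<phi> :: "'a \<Rightarrow> 'a" and \<kappa> C :: real
  assumes U: "open U" "q \<notin> U" and pq: "p \<noteq> q" and \<kappa>: "0 \<le> \<kappa>" "\<kappa> < 1" and C: "C > 0"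
    and \<phi>: "x \<in> U \<Longrightarrow> \<phi> x \<in> U"
    and contraction: "x \<in> U \<Longrightarrow> norm (\<phi> x - p) * norm (x - q) = \<kappa> * norm (\<phi> x - q) * norm (x - p)"
    and act_word: "x \<in> U \<Longrightarrow> act (word g (\<lambda>_. a) j) (bdry x) = bdry ((\<phi> ^^ Suc j) x)"
    and distortion: "x \<in> U \<Longrightarrow> distortion act g D N (bdry (\<phi> x))
      = ln (C * (norm (x - q) / norm (\<phi> x - q))\<^sup>2 * (1 + (norm (\<phi> x))\<^sup>2) / (1 + (norm x)\<^sup>2))"
begin

lemma funpow_in: "x \<in> U \<Longrightarrow> (\<phi> ^^ n) x \<in> U"
  by (induction n) (auto intro: \<phi>)

lemma orbit_tendsto: "x \<in> U \<Longrightarrow> (\<lambda>n. (\<phi> ^^ n) x) \<longlonglongrightarrow> p"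
  using funpow_in[of x] U(2)
  by (intro tendsto_of_ratio_contraction[OF \<kappa> pq]) (auto simp: contraction)

text \<open>Each distortion is ln C plus an increment of K along the orbit. The terms ln C cancel
  between u and u', and the increments telescope to K p on both sides because both orbits converge
  to p.\<close>

lemma delta_eq:
  assumes u: "u \<in> U" "u' \<in> U"
  shows "delta act g D N (\<lambda>_. a) u u'
    = (2 * ln (norm (u - q)) - ln (1 + (norm u)\<^sup>2)) - (2 * ln (norm (u' - q)) - ln (1 + (norm u')\<^sup>2))"
proof -
  define K where "K x = ln (1 + (norm x)\<^sup>2) - 2 * ln (norm (x - q))" for x
  have d: "distortion act g D N (act (word g (\<lambda>_. a) j) (bdry x))
      = ln C + (K ((\<phi> ^^ Suc j) x) - K ((\<phi> ^^ j) x))" if "x \<in> U" for x j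
  proof -
    define y where "y = (\<phi> ^^ j) x"
    have y: "y \<in> U" "norm (y - q) > 0" "norm (\<phi> y - q) > 0"
      using funpow_in[OF that] \<phi> U(2) by (auto simp: y_def)
    have "distortion act g D N (act (word g (\<lambda>_. a) j) (bdry x)) = distortion act g D N (bdry (\<phi> y))"
      using that by (simp add: act_word y_def)
    also have "\<dots> = ln C + (K (\<phi> y) - K y)"
      unfolding distortion[OF y(1)] K_def using C y(2,3)
      by (simp add: ln_mult ln_div ln_realpow)
    finally show ?thesis by (simp add: y_def)
  qed
  have K: "isCont K p" unfolding K_def using pq by (intro continuous_intros) auto
  have l: "(\<lambda>n. K ((\<phi> ^^ n) x)) \<longlonglongrightarrow> K p" if "x \<in> U" for x
    by (rule isCont_tendsto_compose[OF K orbit_tendsto[OF that]])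
  have "(\<lambda>n. K ((\<phi> ^^ n) u) - K ((\<phi> ^^ n) u')) \<longlonglongrightarrow> K p - K p"
    by (intro tendsto_intros l u)
  from telescope_sums[OF this]
  have "(\<lambda>j. distortion act g D N (act (word g (\<lambda>_. a) j) (bdry u))
      - distortion act g D N (act (word g (\<lambda>_. a) j) (bdry u')))
    sums (K p - K p - (K u - K u'))"
    by (simp add: d u algebra_simps)
  then show ?thesis by (simp add: delta_def sums_iff K_def)
qed

end

text \<open>The only derivative required: the term ln (1 + |u|^2) is the same for both generators
  and cancels in \<phi>. The result is twice the inversion of x at q.\<close>

lemma GDERIV_two_ln_norm:
  fixes q :: "'a::real_inner"
  assumes "x \<noteq> q"
  shows "GDERIV (\<lambda>u. 2 * ln (norm (u - q))) x :> (2 / (norm (x - q))\<^sup>2) *\<^sub>R (x - q)"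
proof -
  have "((\<lambda>u. 2 * ln (norm (u - q))) has_derivative
      (\<lambda>h. 2 * ((h \<bullet> sgn (x - q)) / norm (x - q)))) (at x)"
  proof -
    have "((\<lambda>u. u - q) has_derivative (\<lambda>h. h)) (at x)"
      by (auto intro!: derivative_eq_intros)
    moreover have "(norm has_derivative (\<lambda>h. h \<bullet> sgn (x - q))) (at (x - q))"
      using GDERIV_norm[of "x - q"] assms by (simp add: gderiv_def)
    ultimately have "((\<lambda>u. norm (u - q)) has_derivative (\<lambda>h. h \<bullet> sgn (x - q))) (at x)"
      by (rule has_derivative_compose)
    then show ?thesis
      using assms by (auto intro!: derivative_eq_intros simp: divide_inverse)
  qed
  moreover have "(\<lambda>h. 2 * ((h \<bullet> sgn (x - q)) / norm (x - q)))
      = (\<lambda>h. h \<bullet> ((2 / (norm (x - q))\<^sup>2) *\<^sub>R (x - q)))"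
    by (auto simp: sgn_div_norm power2_eq_square divide_simps)
  ultimately show ?thesis by (simp add: gderiv_def)
qed

text \<open>The letter k is a itself, so the admissible pairs required are (a, a), (a, b) and (b,
  b). The points \<open>x n\<close> form the orbit of o under the powers of
  \<open>g a\<close>.\<close>

lemma LNIC_of_attracting_generators:
  fixes act :: "'k::semiring_1^'d^'d \<Rightarrow> 'a hpt \<Rightarrow> 'a::euclidean_space hpt"
  assumes A: "attracting_generator act g D N a U p q \<phi> \<kappa> C"
    and B: "attracting_generator act g D N b V p' q' \<phi>' \<kappa>' C'"
    and ab: "a \<in> {1..N}" "b \<in> {1..N}" "adm a a" "adm a b" "adm b b"
    and p: "p \<in> U" "p \<in> V" "p \<in> D a"
    and qq: "q \<noteq> q'"
    and x: "\<And>n. act (word g (\<lambda>_. a) n) base_pt = Some (x n)" "\<And>n. snd (x n) \<noteq> 0" "x \<longlonglongrightarrow> (p, 0)"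
  shows "LNIC act g D N adm"
proof -
  interpret A: attracting_generator act g D N a U p q \<phi> \<kappa> C by (rule A)
  interpret B: attracting_generator act g D N b V p' q' \<phi>' \<kappa>' C' by (rule B)
  have "word g (\<lambda>_. a) n \<in> semigroup_generated (g ` {1..N})" for n
    using ab(1)
    by (induction n) (auto intro: semigroup_generated.product semigroup_generated.generator
        simp del: atLeastAtMost_iff)
  then have "range x \<subseteq> {q. \<exists>A\<in>semigroup_generated (g ` {1..N}). act A base_pt = Some q}"
    using x(1) by blast
  \<comment> \<open>A limit point needs approximating points different from it; the nonzero last
    coordinate provides that.\<close>
  moreover have "(p, 0) islimpt range x"
    unfolding islimpt_sequential using x(2,3) by (intro exI[of _ x]) (auto, metis snd_conv)
  ultimately have lim: "p \<in> limit_set act (semigroup_generated (g ` {1..N}))"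
    unfolding limit_set_def using islimpt_subset by blast
  have pq: "p \<noteq> q" "p \<noteq> q'" using p A.U B.U by auto
  define c where "c = (2 * ln (norm (p - q'))) - (2 * ln (norm (p - q)))"
  define v where "v = (2 / (norm (p - q))\<^sup>2) *\<^sub>R (p - q) - (2 / (norm (p - q'))\<^sup>2) *\<^sub>R (p - q')"
  have "GDERIV (\<lambda>u. (2 * ln (norm (u - q)) - 2 * ln (norm (u - q'))) + c) p :> v - 0 + 0"
    using GDERIV_diff[OF GDERIV_two_ln_norm[OF pq(1)] GDERIV_two_ln_norm[OF pq(2)]]
    unfolding v_def by (intro GDERIV_add GDERIV_const) simp
  then have 1: "((\<lambda>u. (2 * ln (norm (u - q)) - 2 * ln (norm (u - q'))) + c) has_derivative (\<lambda>h. h \<bullet> v)) (at p)"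
    by (simp add: gderiv_def)
  have "((\<lambda>u. temporal_distance act g D N (\<lambda>_. a) (\<lambda>_. b) u p) has_derivative (\<lambda>h. h \<bullet> v)) (at p)"
    by (rule has_derivative_transform_within_open[OF 1, of "U \<inter> V"])
      (use p A.U B.U in \<open>auto simp: temporal_distance_def A.delta_eq B.delta_eq c_def\<close>)
  then have G: "GDERIV (\<lambda>u. temporal_distance act g D N (\<lambda>_. a) (\<lambda>_. b) u p) p :> v"
    by (simp add: gderiv_def)
  have "v \<noteq> 0"
  proof
    assume "v = 0"
    then have *: "(1 / (norm (p - q))\<^sup>2) *\<^sub>R (p - q) = (1 / (norm (p - q'))\<^sup>2) *\<^sub>R (p - q')"
    proof -
      have "2 *\<^sub>R ((1 / (norm (p - q))\<^sup>2) *\<^sub>R (p - q)) = 2 *\<^sub>R ((1 / (norm (p - q'))\<^sup>2) *\<^sub>R (p - q'))"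
        using \<open>v = 0\<close> unfolding v_def scaleR_scaleR by simp
      then show ?thesis by (simp only: scaleR_cancel_left) simp
    qed
    \<comment> \<open>Inversion takes distance to reciprocal distance, so equal images give |p - q|
      = |p - q'|, after which the vectors themselves agree.\<close>
    have n: "norm ((1 / (norm (p - r))\<^sup>2) *\<^sub>R (p - r)) = 1 / norm (p - r)" for r
      by (simp add: power2_eq_square)
    have "1 / norm (p - q) = 1 / norm (p - q')" using n[of q] n[of q'] * by simp
    then have "norm (p - q) = norm (p - q')" by simp
    with * pq show False using qq by simp
  qed
  moreover have "(\<lambda>_. a) \<in> admissible_seqs N adm" "(\<lambda>_. b) \<in> admissible_seqs N adm"
    using ab by (auto simp: admissible_seqs_def)
  ultimately show ?thesis
    unfolding LNIC_def Let_def using ab p lim G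
    by (intro bexI[of _ "\<lambda>_. a"] bexI[of _ "\<lambda>_. b"] bexI[of _ a] conjI bexI[of _ p] exI[of _ v]) auto
qed

text \<open>Around an interior point of \<open>D a\<close>, disjointness makes the
  \<open>THE\<close> in \<open>expanding_map\<close> equal to a. The expanding map is then the
  inverse branch \<psi>, for which differentiability and the two-point identity suffice.\<close>

lemma distortion_of_inverse_branch:
  fixes \<psi> :: "'a::euclidean_space \<Rightarrow> 'a"
  assumes a: "a \<in> {1..N}" and D: "\<And>j. j \<in> {1..N} \<Longrightarrow> j \<noteq> a \<Longrightarrow> D j \<inter> D a = {}"
    and y: "y \<in> interior (D a)"
    and inv: "\<forall>\<^sub>F z in nhds y. act (matrix_inv (g a)) (bdry z) = bdry (\<psi> z)"
    and \<psi>: "\<psi> differentiable (at y)" and m: "isCont m y" "m y > 0"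
    and conf: "\<forall>\<^sub>F z in nhds y. (norm (\<psi> z - \<psi> y))\<^sup>2 = m z * m y * (norm (z - y))\<^sup>2"
  shows "distortion act g D N (bdry y) = ln (m y * (1 + (norm y)\<^sup>2) / (1 + (norm (\<psi> y))\<^sup>2))"
proof -
  obtain \<psi>' where \<psi>': "(\<psi> has_derivative \<psi>') (at y)" using \<psi> by (auto simp: differentiable_def)
  have the: "(THE j. j \<in> {1..N} \<and> bdry z \<in> bdry ` D j) = a" if "z \<in> D a" for z
    using a D that by (intro the_equality) (auto simp: bdry_def)
  have "\<forall>\<^sub>F z in nhds y. z \<in> interior (D a)" using y by (intro eventually_nhds_in_open) auto
  with inv have "\<forall>\<^sub>F z in nhds y. expanding_map act g D N (bdry z) = bdry (\<psi> z)"
    by eventually_elim (use the interior_subset[of "D a"] in \<open>auto simp only: expanding_map_def\<close>)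
  moreover have "norm (\<psi>' v) = m y * norm v" for v
  proof (rule norm_conformal_derivative[OF \<psi>' m(1)])
    show "\<forall>\<^sub>F z in at y. (norm (\<psi> z - \<psi> y))\<^sup>2 = m z * m y * (norm (z - y))\<^sup>2"
      using conf unfolding eventually_at_filter by eventually_elim simp
  qed (use m in simp)
  ultimately show ?thesis by (rule distortion_eq[OF _ \<psi>'])
qed

section \<open>Zariski density and Moebius transformations\<close>

lemma matrix_inv_eqI:
  fixes A B :: "'a::semiring_1^'n^'n"
  assumes "A ** B = mat 1" "B ** A = mat 1"
  shows "matrix_inv A = B"
proof -
  have "\<exists>A'. A ** A' = mat 1 \<and> A' ** A = mat 1" using assms by blast
  from someI_ex[OF this] have "A ** matrix_inv A = mat 1 \<and> matrix_inv A ** A = mat 1"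
    by (simp add: matrix_inv_def)
  then show ?thesis using assms
    by (metis matrix_mul_assoc matrix_mul_lid matrix_mul_rid)
qed

lemma semigroup_generated_commute:
  assumes S: "\<And>A B. A \<in> S \<Longrightarrow> B \<in> S \<Longrightarrow> A ** B = B ** A"
    and "A \<in> semigroup_generated S" "B \<in> semigroup_generated S"
  shows "A ** B = B ** A"
proof -
  have *: "A ** B = B ** A" if "A \<in> semigroup_generated S" "B \<in> S" for A B
    using that
    by induction (auto intro: S, metis matrix_mul_assoc)
  show ?thesis using assms(3,2)
    by induction (auto intro: *, metis matrix_mul_assoc)
qed

lemma entry_polynomial_sum:
  assumes "finite I" "\<And>k. k \<in> I \<Longrightarrow> entry_polynomial (f k)"
  shows "entry_polynomial (\<lambda>A. \<Sum>k\<in>I. f k A)"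
  using assms by (induction rule: finite_induct) (auto intro: entry_polynomial.intros)

text \<open>\<open>entry_polynomial\<close> has no rule for subtraction, so the minus sign is
  absorbed into the constant coefficients from B.\<close>

lemma entry_polynomial_commutator:
  "entry_polynomial (\<lambda>A. (A ** B - B ** A) $ i $ j)"
proof -
  have "entry_polynomial (\<lambda>A. (\<Sum>k\<in>UNIV. A $ i $ k * B $ k $ j) + (\<Sum>k\<in>UNIV. (- (B $ i $ k)) * A $ k $ j))"
    by (intro entry_polynomial.intros entry_polynomial_sum) auto
  moreover have "(A ** B - B ** A) $ i $ j
      = (\<Sum>k\<in>UNIV. A $ i $ k * B $ k $ j) + (\<Sum>k\<in>UNIV. (- (B $ i $ k)) * A $ k $ j)" for A
    by (simp add: matrix_matrix_mult_def sum_negf)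
  ultimately show ?thesis by simp
qed

text \<open>For fixed B, commuting with B is a polynomial condition. Density is applied twice, first
  with B in \<Gamma> and then with B in G.\<close>

lemma zariski_dense_in_commute:
  assumes "zariski_dense_in \<Gamma> G" and \<Gamma>: "\<And>A B. A \<in> \<Gamma> \<Longrightarrow> B \<in> \<Gamma> \<Longrightarrow> A ** B = B ** A"
    and "A \<in> G" "B \<in> G"
  shows "A ** B = B ** A"
proof -
  have *: "A ** B = B ** A" if "A \<in> G" "\<And>C. C \<in> \<Gamma> \<Longrightarrow> C ** B = B ** C" for A B
  proof -
    have "(A ** B - B ** A) $ i $ j = 0" for i j
      using assms(1) entry_polynomial_commutator[of B i j] that
      unfolding zariski_dense_in_def by fastforce
    then have "A ** B - B ** A = 0" by (simp add: vec_eq_iff)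
    then show ?thesis by simp
  qed
  have "A ** C = C ** A" if "C \<in> \<Gamma>" for C using *[OF assms(3)] \<Gamma> that by blast
  then show ?thesis using *[OF assms(4), of A] by metis
qed

lemma SL2C_not_commutative: "\<exists>A\<in>SL2C. \<exists>B\<in>SL2C. A ** B \<noteq> B ** A"
proof -
  define A :: "complex^2^2" where "A = vector [vector [1, 1], vector [0, 1]]"
  define B :: "complex^2^2" where "B = vector [vector [1, 0], vector [1, 1]]"
  have "A \<in> SL2C" "B \<in> SL2C" by (auto simp: SL2C_def A_def B_def det_2)
  moreover have "(A ** B) $ 1 $ 1 \<noteq> (B ** A) $ 1 $ 1"
    by (simp add: A_def B_def matrix_matrix_mult_def sum_2)
  ultimately show ?thesis by metis
qed

section \<open>Linear fractional action and orbits of the base point\<close>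

definition moebius_map :: "complex^2^2 \<Rightarrow> complex \<Rightarrow> complex" where
  "moebius_map A z = (A $ 1 $ 1 * z + A $ 1 $ 2) / (A $ 2 $ 1 * z + A $ 2 $ 2)"

text \<open>At height 0 the Poincare extension reduces to the fraction, because the conjugate of w
  divided by |w|^2 is 1 / w.\<close>

lemma act_SL2_bdry:
  "act_SL2 A (bdry z)
    = (if A $ 2 $ 1 * z + A $ 2 $ 2 = 0 then None else bdry (moebius_map A z))"
proof (cases "A $ 2 $ 1 * z + A $ 2 $ 2 = 0")
  case False
  let ?w = "A $ 2 $ 1 * z + A $ 2 $ 2"
  have "(A $ 1 $ 1 * z + A $ 1 $ 2) * cnj ?w / complex_of_real ((cmod ?w)\<^sup>2) = moebius_map A z"
  proof -
    have "u * cnj w / complex_of_real ((cmod w)\<^sup>2) = u / w" if "w \<noteq> 0" for u w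
      using that unfolding complex_norm_square by simp
    then show ?thesis unfolding moebius_map_def using False .
  qed
  with False show ?thesis by (simp add: act_SL2_def bdry_def Let_def)
qed (simp add: act_SL2_def bdry_def)

text \<open>B sends the vector (z, 1) to a nonzero multiple of (w, 1), and the multiple drops out.
  The assumption says that the intermediate point is finite.\<close>

lemma act_SL2_mult_bdry:
  assumes "act_SL2 B (bdry z) = bdry w"
  shows "act_SL2 (A ** B) (bdry z) = act_SL2 A (bdry w)"
proof -
  let ?c = "B $ 2 $ 1 * z + B $ 2 $ 2"
  have c: "?c \<noteq> 0" and w: "w = moebius_map B z"
    using assms unfolding act_SL2_bdry by (auto simp: bdry_def split: if_splits)
  have e: "(A ** B) $ i $ 1 * z + (A ** B) $ i $ 2 = (A $ i $ 1 * w + A $ i $ 2) * ?c" for i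
    using c unfolding w moebius_map_def
    by (simp add: matrix_matrix_mult_def sum_2 field_simps)
  show ?thesis
    unfolding act_SL2_bdry moebius_map_def e using c by simp
qed

text \<open>Cauchy-Schwarz; the square added in the middle completes the Lagrange identity.\<close>

lemma cmod_linear_square_le:
  "(cmod (u * p + v))\<^sup>2 \<le> ((cmod u)\<^sup>2 + (cmod v)\<^sup>2) * (1 + (cmod p)\<^sup>2)"
proof -
  have "(cmod (u * p + v))\<^sup>2 \<le> (cmod u * cmod p + cmod v)\<^sup>2"
    by (intro power_mono) (auto simp: norm_mult[symmetric] norm_triangle_ineq)
  also have "\<dots> \<le> (cmod u * cmod p + cmod v)\<^sup>2 + (cmod u - cmod v * cmod p)\<^sup>2" by simp
  also have "\<dots> = ((cmod u)\<^sup>2 + (cmod v)\<^sup>2) * (1 + (cmod p)\<^sup>2)"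
    by (simp add: power2_eq_square algebra_simps)
  finally show ?thesis .
qed

text \<open>If (p, 1) is an eigenvector with large eigenvalue l, then o lands near p. Its height is
  1 / Q with Q = |c|^2 + |d|^2, and l = c p + d gives |l|^2 \<le> Q (1 + |p|^2).\<close>

lemma act_SL2_base_pt_near_fixed_point:
  assumes det: "det A = 1"
    and fix1: "A $ 1 $ 1 * p + A $ 1 $ 2 = l * p" and fix2: "A $ 2 $ 1 * p + A $ 2 $ 2 = l"
  obtains z t where "act_SL2 A base_pt = Some (z, t)" "t > 0"
    "t \<le> (1 + (cmod p)\<^sup>2) / (cmod l)\<^sup>2" "cmod (z - p) \<le> (1 + (cmod p)\<^sup>2) / (cmod l)\<^sup>2"
proof -
  define a b c d where abcd: "a = A $ 1 $ 1" "b = A $ 1 $ 2" "c = A $ 2 $ 1" "d = A $ 2 $ 2"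
  define Q P where "Q = (cmod d)\<^sup>2 + (cmod c)\<^sup>2" and "P = 1 + (cmod p)\<^sup>2"
  define z where "z = (b * cnj d + a * cnj c) / complex_of_real Q"
  have ad: "a * d - b * c = 1" using det by (simp add: det_2 abcd)
  have b: "b = l * p - a * p" and d: "d = l - c * p" using fix1 fix2 by (auto simp: abcd algebra_simps)
  \<comment> \<open>Here a - p c is the second eigenvalue, the inverse of l since the determinant is
    1.\<close>
  have al: "(a - p * c) * l = 1" using ad unfolding b d by (simp add: algebra_simps)
  have l: "l \<noteq> 0" using al by auto
  have P: "P > 0" by (simp add: P_def add_pos_nonneg)
  have lQ: "(cmod l)\<^sup>2 \<le> Q * P"
    using cmod_linear_square_le[of c p d] d by (simp add: Q_def P_def add.commute)
  have "0 < Q * P" using l by (intro less_le_trans[OF _ lQ]) simp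
  then have Q: "Q > 0" using P by (metis zero_less_mult_pos2)
  have iQ: "1 / Q \<le> P / (cmod l)\<^sup>2" using lQ Q l by (simp add: field_simps)
  have act: "act_SL2 A base_pt = Some (z, 1 / Q)"
  proof -
    have "d = 0 \<longrightarrow> c \<noteq> 0" using Q by (auto simp: Q_def)
    then show ?thesis using det
      by (simp add: act_SL2_def base_pt_def Let_def z_def flip: abcd Q_def)
  qed
  have QQ: "complex_of_real Q = d * cnj d + c * cnj c"
    unfolding Q_def by (simp only: of_real_add complex_norm_square)
  have zQ: "(z - p) * complex_of_real Q = (a - p * c) * (cnj c - p * cnj d)"
  proof -
    have "(z - p) * complex_of_real Q = b * cnj d + a * cnj c - p * (d * cnj d + c * cnj c)"
      using Q unfolding left_diff_distrib QQ[symmetric] by (simp add: z_def)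
    then show ?thesis unfolding b by (simp add: d algebra_simps)
  qed
  have "(z - p) * complex_of_real Q * l = ((a - p * c) * l) * (cnj d * (- p) + cnj c)"
    unfolding zQ by (simp add: algebra_simps)
  then have "cmod ((z - p) * complex_of_real Q * l) = cmod (cnj d * (- p) + cnj c)"
    unfolding al by simp
  then have "cmod (z - p) * Q * cmod l = cmod (cnj d * (- p) + cnj c)"
    using Q by (simp add: norm_mult)
  then have "(cmod (z - p) * Q * cmod l)\<^sup>2 \<le> Q * P"
    using cmod_linear_square_le[of "cnj d" "- p" "cnj c"] by (simp add: Q_def P_def)
  then have "(cmod (z - p))\<^sup>2 * (Q * (cmod l)\<^sup>2) * Q \<le> P * Q"
    by (simp add: power2_eq_square mult_ac)
  then have "(cmod (z - p))\<^sup>2 * (Q * (cmod l)\<^sup>2) \<le> P"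
    using Q by (rule mult_right_le_imp_le)
  then have "(cmod (z - p))\<^sup>2 \<le> (P / (cmod l)\<^sup>2) * (1 / Q)"
    using Q l by (simp add: field_simps)
  also have "\<dots> \<le> (P / (cmod l)\<^sup>2) * (P / (cmod l)\<^sup>2)"
    using iQ P by (intro mult_left_mono) auto
  finally have "(cmod (z - p))\<^sup>2 \<le> (P / (cmod l)\<^sup>2)\<^sup>2" by (simp add: power2_eq_square)
  then have "cmod (z - p) \<le> P / (cmod l)\<^sup>2" by (rule power2_le_imp_le) (use P in simp)
  with act Q iQ that show thesis by (simp add: P_def)
qed

text \<open>The roots of z^2 + a z - 1, i.e. the fixed points of z \<mapsto> 1 / (z + a). Their
  moduli are reciprocal. If both were 1, q would be minus the conjugate of p and the sum would be
  purely imaginary, contradicting Re a \<ge> 1.\<close>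

lemma cf_fixed_points:
  fixes a :: complex
  assumes "Re a \<ge> 1"
  obtains p q where "p + q = - a" "p * q = - 1" "cmod p < 1" "cmod q > 1"
proof -
  define s where "s = csqrt (a\<^sup>2 + 4)"
  define p q where "p = (- a + s) / 2" and "q = (- a - s) / 2"
  have sum: "p + q = - a" by (simp add: p_def q_def field_simps)
  have "s * s = a\<^sup>2 + 4" by (simp add: s_def flip: power2_eq_square)
  then have prod: "p * q = - 1" by (simp add: p_def q_def field_simps power2_eq_square)
  have pq: "cmod p * cmod q = 1" using prod by (metis norm_mult norm_minus_cancel norm_one)
  have "cmod p \<noteq> 1"
  proof
    assume p: "cmod p = 1"
    have "p * cnj p = 1" using p by (metis complex_norm_square of_real_1 one_power2)
    then have "p * q = p * (- cnj p)" using prod by simp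
    moreover have "p \<noteq> 0" using p by auto
    ultimately have "q = - cnj p" by (simp only: mult_cancel_left) simp
    then have "Re (p + q) = 0" by simp
    then show False using assms sum by simp
  qed
  have *: "cmod y > 1" if "cmod x < 1" "cmod x * cmod y = 1" for x y :: complex
  proof (rule ccontr)
    assume "\<not> cmod y > 1"
    then have "cmod x * cmod y \<le> cmod x" by (intro mult_left_le) auto
    with that show False by simp
  qed
  show thesis
  proof (cases "cmod p < 1")
    case True
    then show ?thesis using *[of p q] pq sum prod that by blast
  next
    case False
    have "cmod q < 1"
    proof (rule ccontr)
      assume "\<not> cmod q < 1"
      then have "cmod p \<le> cmod p * cmod q" by (simp add: mult_le_cancel_left1)
      with False \<open>cmod p \<noteq> 1\<close> pq show False by simp
    qed
    then show ?thesis using *[of q p] pq sum prod that[of q p] by (simp add: add.commute mult.commute)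
  qed
qed

section \<open>Continued fractions\<close>

lemma interior_if_eventually_nhds:
  assumes "\<forall>\<^sub>F z in nhds y. z \<in> S"
  shows "y \<in> interior S"
  using assms by (auto simp: eventually_nhds interior_def)

lemma cf_matrix_entries [simp]:
  "cf_matrix a $ 1 $ 1 = 0" "cf_matrix a $ 1 $ 2 = 1" "cf_matrix a $ 2 $ 1 = 1" "cf_matrix a $ 2 $ 2 = a"
  by (simp_all add: cf_matrix_def)

lemma act_SL2_cf_matrix: "z + a \<noteq> 0 \<Longrightarrow> act_SL2 (cf_matrix a) (bdry z) = bdry (1 / (z + a))"
  by (simp add: act_SL2_bdry moebius_map_def)

lemma cf_matrix_square_entries:
  "(cf_matrix a ** cf_matrix a) $ 1 $ 1 = 1" "(cf_matrix a ** cf_matrix a) $ 1 $ 2 = a"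
  "(cf_matrix a ** cf_matrix a) $ 2 $ 1 = a" "(cf_matrix a ** cf_matrix a) $ 2 $ 2 = 1 + a\<^sup>2"
  by (simp_all add: matrix_matrix_mult_def sum_2 power2_eq_square)

lemma matrix_inv_cf_matrix_square:
  "matrix_inv (cf_matrix a ** cf_matrix a) = vector [vector [1 + a\<^sup>2, - a], vector [- a, 1]]"
  by (rule matrix_inv_eqI; simp add: vec_eq_iff forall_2 matrix_matrix_mult_def[of "cf_matrix a ** cf_matrix a"]
      matrix_matrix_mult_def[of _ "cf_matrix a ** cf_matrix a"] sum_2 cf_matrix_square_entries mat_def power2_eq_square algebra_simps)

lemma det_cf_matrix [simp]: "det (cf_matrix a) = - 1"
  by (simp add: det_2)

lemma cf_region_Re_pos: "0 < \<epsilon> \<Longrightarrow> z \<in> cf_region \<epsilon> \<Longrightarrow> Re z > 0"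
  by (simp add: cf_region_def)

text \<open>The disc has centre and radius 1 / (2 + \<epsilon>), so its points have modulus at most
  2 / (2 + \<epsilon>). This keeps the repelling fixed points, of modulus above 1, outside the
  region.\<close>

lemma cf_region_cmod_less_1:
  assumes "0 < \<epsilon>" "z \<in> cf_region \<epsilon>"
  shows "cmod z < 1"
proof -
  have "cmod z \<le> cmod (complex_of_real (1 / (2 + \<epsilon>))) + cmod (z - complex_of_real (1 / (2 + \<epsilon>)))"
    by (rule norm_triangle_sub)
  also have "\<dots> \<le> 1 / (2 + \<epsilon>) + 1 / (2 + \<epsilon>)"
    using assms by (intro add_mono) (auto simp: cf_region_def simp del: of_real_divide)
  also have "\<dots> < 1" using assms(1) by (simp add: field_simps)
  finally show ?thesis .
qed

lemma closed_cf_region: "closed (cf_region \<epsilon>)"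
  unfolding cf_region_def by (intro closed_Collect_conj closed_Collect_le continuous_intros)

text \<open>The bound \<epsilon> < sqrt 3 - 1 gives \<epsilon> (2 + \<epsilon>) \<le> 2, which
  places the rightmost point 2 / (2 + \<epsilon>) of the disc to the right of the line Re \<xi> =
  \<epsilon>.\<close>

lemma cf_region_nonempty:
  assumes "0 < \<epsilon>" "\<epsilon> < sqrt 3 - 1"
  shows "cf_region \<epsilon> \<noteq> {}"
proof -
  have "(\<epsilon> + 1)\<^sup>2 \<le> (sqrt 3)\<^sup>2" using assms by (intro power_mono) auto
  then have "\<epsilon> * (2 + \<epsilon>) \<le> 2" by (simp add: power2_eq_square algebra_simps)
  then have e: "\<epsilon> \<le> 2 / (2 + \<epsilon>)" using assms by (simp add: field_simps)
  have "complex_of_real (2 / (2 + \<epsilon>)) - complex_of_real (1 / (2 + \<epsilon>)) = complex_of_real (1 / (2 + \<epsilon>))"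
    unfolding of_real_diff[symmetric] by (simp add: diff_divide_distrib[symmetric])
  then have "complex_of_real (2 / (2 + \<epsilon>)) \<in> cf_region \<epsilon>"
    using assms e by (simp add: cf_region_def norm_divide del: of_real_divide)
  then show ?thesis by blast
qed

section \<open>Dynamics of the continued fractions semigroup\<close>

locale cf_semigroup =
  fixes A :: "complex set" and \<epsilon> :: real and h :: "nat \<Rightarrow> complex^2^2" and E :: "nat \<Rightarrow> complex set"
  assumes setting: "cf_setting A \<epsilon> h E"
begin

abbreviation "R \<equiv> cf_region \<epsilon>"

lemma eps: "0 < \<epsilon>" "\<epsilon> < sqrt 3 - 1"
  using setting by (auto simp: cf_setting_def)

lemma Re_ge_1: "a \<in> A \<Longrightarrow> Re a \<ge> 1"
  using setting unfolding cf_setting_def by force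

lemma denominator_nonzero:
  assumes "a \<in> A" "z \<in> R"
  shows "z + a \<noteq> 0"
proof
  assume "z + a = 0"
  then have "Re z + Re a = 0" by (metis plus_complex.sel(1) zero_complex.sel(1))
  then show False using Re_ge_1[OF assms(1)] cf_region_Re_pos[OF eps(1) assms(2)] by simp
qed

lemma step:
  assumes "a \<in> A" "z \<in> R"
  shows "1 / (z + a) \<in> interior R" "1 / (z + a) \<in> R"
proof -
  have "act_SL2 (cf_matrix a) (bdry z) \<in> bdry ` interior R"
    using setting assms unfolding cf_setting_def by blast
  then show "1 / (z + a) \<in> interior R"
    unfolding act_SL2_cf_matrix[OF denominator_nonzero[OF assms]] by (auto simp: bdry_def)
  then show "1 / (z + a) \<in> R" using interior_subset by blast
qed

lemma step_inj:
  assumes "a \<in> A" "b \<in> A" "z \<in> R" "w \<in> R" "1 / (z + a) = 1 / (w + b)"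
  shows "a = b \<and> z = w"
proof -
  have "act_SL2 (cf_matrix a) (bdry z) = act_SL2 (cf_matrix b) (bdry w)"
    using assms by (simp add: act_SL2_cf_matrix denominator_nonzero)
  then have "(act_SL2 (cf_matrix a) ` bdry ` R) \<inter> (act_SL2 (cf_matrix b) ` bdry ` R) \<noteq> {}"
    using assms(3,4) by blast
  moreover have "disjoint_family_on (\<lambda>a. act_SL2 (cf_matrix a) ` bdry ` R) A"
    using setting by (simp add: cf_setting_def)
  ultimately have "a = b" using assms(1,2) unfolding disjoint_family_on_def by blast
  then show ?thesis using assms(5) by simp
qed

lemma act_two_steps:
  assumes "a \<in> A" "b \<in> A" "z \<in> R"
  shows "act_SL2 (cf_matrix a ** cf_matrix b) (bdry z) = bdry (1 / (1 / (z + b) + a))"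
  unfolding act_SL2_mult_bdry[OF act_SL2_cf_matrix[OF denominator_nonzero[OF assms(2,3)]]]
  by (intro act_SL2_cf_matrix denominator_nonzero step assms)

lemma enumeration:
  obtains e where "bij_betw e {1..(card A)\<^sup>2} (A \<times> A)"
    "\<forall>j\<in>{1..(card A)\<^sup>2}. h j = cf_matrix (fst (e j)) ** cf_matrix (snd (e j))"
    "\<forall>j\<in>{1..(card A)\<^sup>2}. E j = (\<lambda>z. 1 / (1 / (z + snd (e j)) + fst (e j))) ` R"
proof -
  have "\<exists>e. bij_betw e {1..(card A)\<^sup>2} (A \<times> A) \<and>
      (\<forall>j\<in>{1..(card A)\<^sup>2}. h j = cf_matrix (fst (e j)) ** cf_matrix (snd (e j)) \<and>
         bdry ` E j = act_SL2 (h j) ` bdry ` R)"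
    using setting unfolding cf_setting_def by (elim conjE)
  then obtain e where e: "bij_betw e {1..(card A)\<^sup>2} (A \<times> A)"
      "\<forall>j\<in>{1..(card A)\<^sup>2}. h j = cf_matrix (fst (e j)) ** cf_matrix (snd (e j)) \<and>
         bdry ` E j = act_SL2 (h j) ` bdry ` R"
    by (elim exE conjE)
  have "E j = (\<lambda>z. 1 / (1 / (z + snd (e j)) + fst (e j))) ` R" if j: "j \<in> {1..(card A)\<^sup>2}" for j
  proof -
    have ej: "fst (e j) \<in> A" "snd (e j) \<in> A"
      using bij_betwE[OF e(1)] j by (auto simp: mem_Times_iff)
    have "bdry ` E j = bdry ` (\<lambda>z. 1 / (1 / (z + snd (e j)) + fst (e j))) ` R"
      using bspec[OF e(2) j] act_two_steps[OF ej] by (simp add: image_image)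
    moreover have "inj (bdry :: complex \<Rightarrow> _)" by (auto simp: inj_def bdry_def)
    ultimately show ?thesis by (simp add: inj_image_eq_iff)
  qed
  moreover have "h j = cf_matrix (fst (e j)) ** cf_matrix (snd (e j))" if "j \<in> {1..(card A)\<^sup>2}" for j
    using bspec[OF e(2) that] by (rule conjunct1)
  ultimately show thesis using e(1) by (intro that ballI)
qed

text \<open>The setting gives disjointness for single letters only. A common point of two cylinders
  yields equal outer letters and equal inner values, and then equal inner letters.\<close>

lemma disjoint_cylinders:
  assumes "j \<in> {1..(card A)\<^sup>2}" "k \<in> {1..(card A)\<^sup>2}" "j \<noteq> k"
  shows "E j \<inter> E k = {}"
proof (rule ccontr)
  obtain e where e: "bij_betw e {1..(card A)\<^sup>2} (A \<times> A)"
    "\<forall>j\<in>{1..(card A)\<^sup>2}. h j = cf_matrix (fst (e j)) ** cf_matrix (snd (e j))"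
    "\<forall>j\<in>{1..(card A)\<^sup>2}. E j = (\<lambda>z. 1 / (1 / (z + snd (e j)) + fst (e j))) ` R"
    by (rule enumeration)
  have eA: "fst (e i) \<in> A" "snd (e i) \<in> A" if "i \<in> {1..(card A)\<^sup>2}" for i
    using bij_betwE[OF e(1)] that by (auto simp: mem_Times_iff)
  assume "E j \<inter> E k \<noteq> {}"
  then obtain z w where zw: "z \<in> R" "w \<in> R"
      "1 / (1 / (z + snd (e j)) + fst (e j)) = 1 / (1 / (w + snd (e k)) + fst (e k))"
    unfolding bspec[OF e(3) assms(1)] bspec[OF e(3) assms(2)] by blast
  note s = step(2)[OF eA(2)[OF assms(1)] zw(1)] step(2)[OF eA(2)[OF assms(2)] zw(2)]
  from step_inj[OF eA(1)[OF assms(1)] eA(1)[OF assms(2)] s zw(3)]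
  have 1: "fst (e j) = fst (e k)" "1 / (z + snd (e j)) = 1 / (w + snd (e k))" by auto
  from step_inj[OF eA(2)[OF assms(1)] eA(2)[OF assms(2)] zw(1,2) 1(2)]
  have "e j = e k" using 1(1) by (simp add: prod_eq_iff)
  then show False using assms e(1) by (auto simp: bij_betw_def inj_on_def)
qed

text \<open>With a single letter there would be only one generator, and the semigroup would be
  commutative.\<close>

lemma two_letters: "\<exists>a\<in>A. \<exists>b\<in>A. a \<noteq> b"
proof (rule ccontr)
  assume *: "\<not> ?thesis"
  have z: "zariski_dense_in
       (semigroup_generated {cf_matrix a ** cf_matrix a' | a a'. a \<in> A \<and> a' \<in> A}) SL2C"
    using setting by (simp add: cf_setting_def)
  have "C ** B = B ** C" if "C \<in> SL2C" "B \<in> SL2C" for C B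
  proof (rule zariski_dense_in_commute[OF z _ that], rule semigroup_generated_commute)
    fix C B :: "complex^2^2"
    assume "C \<in> {cf_matrix a ** cf_matrix a' | a a'. a \<in> A \<and> a' \<in> A}"
      "B \<in> {cf_matrix a ** cf_matrix a' | a a'. a \<in> A \<and> a' \<in> A}"
    moreover have "a = b" if "a \<in> A" "b \<in> A" for a b using * that by blast
    ultimately have "C = B" by blast
    then show "C ** B = B ** C" by simp
  qed
  then show False using SL2C_not_commutative by blast
qed

text \<open>The constant sequence at the pair (a, a) iterates the square of g_a, which has the same
  attracting and repelling points p and q as z \<mapsto> 1 / (z + a). The equation for q is kept in
  order to tell two letters apart.\<close>

lemma attracting_generator:
  assumes a: "a \<in> A" and k: "k \<in> {1..(card A)\<^sup>2}" and hk: "h k = cf_matrix a ** cf_matrix a"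
    and Ek: "E k = (\<lambda>z. 1 / (1 / (z + a) + a)) ` R"
  obtains p q \<phi> \<kappa> C x where
    "attracting_generator act_SL2 h E ((card A)\<^sup>2) k (interior R) p q \<phi> \<kappa> C"
    "p \<in> interior R" "p \<in> E k" "q * (q + a) = 1"
    "\<forall>n. act_SL2 (word h (\<lambda>_. k) n) base_pt = Some (x n) \<and> snd (x n) \<noteq> 0" "x \<longlonglongrightarrow> (p, 0)"
proof -
  obtain p q where pq: "p + q = - a" "p * q = - 1" and p1: "cmod p < 1" and q1: "cmod q > 1"
    using cf_fixed_points[OF Re_ge_1[OF a]] by blast
  have "a = - (p + q)" using pq(1) by simp
  then have ap: "a = - p - q" by simp
  have pa: "p + a = - q" and qa: "q + a = - p"
    by (simp_all add: ap)
  have q0: "q \<noteq> 0" "p \<noteq> 0" "p \<noteq> q" using q1 p1 pq by auto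
  have step_p: "1 / (z + a) - p = - p * (z - p) / (z + a)" if "z + a \<noteq> 0" for z
  proof -
    have "1 - p * (z + a) = - p * (z - p)"
      using pq(2) unfolding ap by (simp add: algebra_simps)
    then show ?thesis using that by (simp add: field_simps)
  qed
  have step_q: "1 / (z + a) - q = - q * (z - q) / (z + a)" if "z + a \<noteq> 0" for z
  proof -
    have "1 - q * (z + a) = - q * (z - q)"
      using pq(2) unfolding ap by (simp add: algebra_simps)
    then show ?thesis using that by (simp add: field_simps)
  qed
  have qR: "q \<notin> R" using cf_region_cmod_less_1[OF eps(1)] q1 by force
  \<comment> \<open>To locate p: iterates of a single step starting in R converge to p, R is closed,
    and one more step puts p = 1 / (p + a) into the interior.\<close>
  obtain z0 where z0: "z0 \<in> R" using cf_region_nonempty[OF eps] by blast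
  define y where "y n = ((\<lambda>z. 1 / (z + a)) ^^ n) z0" for n
  have yR: "y n \<in> R" for n by (induction n) (auto simp: y_def z0 step a)
  have "y \<longlonglongrightarrow> p"
  proof (rule tendsto_of_ratio_contraction[where q = q and \<kappa> = "cmod p / cmod q"])
    fix n
    have d: "y n + a \<noteq> 0" by (rule denominator_nonzero[OF a yR])
    have y: "y (Suc n) = 1 / (y n + a)" by (simp add: y_def)
    show "cmod (y (Suc n) - p) * cmod (y n - q) = cmod p / cmod q * cmod (y (Suc n) - q) * cmod (y n - p)"
      unfolding y step_p[OF d] step_q[OF d] using q0 d by (simp add: norm_mult norm_divide)
    show "y n \<noteq> q" using yR[of n] qR by auto
  qed (use p1 q1 q0 in auto)
  then have pR: "p \<in> R" using closed_cf_region yR by (metis closed_sequentially)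
  have fp: "1 / (p + a) = p" using pq(2) q0 unfolding pa by (simp add: field_simps)
  have pU: "p \<in> interior R" using step(1)[OF a pR] fp by simp
  have pE: "p \<in> E k" unfolding Ek using pR fp by (metis (no_types, lifting) image_eqI)
  \<comment> \<open>The denominator of the squared matrix at z; that matrix has determinant
    1.\<close>
  define d where "d z = a * z + 1 + a\<^sup>2" for z
  define \<phi> where "\<phi> z = 1 / (1 / (z + a) + a)" for z
  have \<phi>: "\<phi> z = (z + a) / d z" "d z \<noteq> 0" if z: "z \<in> R" for z
  proof -
    have 1: "z + a \<noteq> 0" "1 / (z + a) + a \<noteq> 0" using denominator_nonzero[OF a] step(2)[OF a] z by auto
    have 2: "1 / (z + a) + a = d z / (z + a)" using 1(1) by (simp add: d_def field_simps power2_eq_square)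
    show "d z \<noteq> 0" using 1 2 by auto
    show "\<phi> z = (z + a) / d z" unfolding \<phi>_def 2 by simp
  qed
  have \<phi>U: "\<phi> z \<in> interior R" if "z \<in> R" for z
    unfolding \<phi>_def by (intro step a that)
  \<comment> \<open>Both follow from p q = -1. Their quotient is the contraction with \<kappa> =
    |p^2| / |q^2|, and the second one expresses |d z| through distances to q.\<close>
  have \<phi>p: "\<phi> z - p = p\<^sup>2 * (z - p) / d z" and \<phi>q: "\<phi> z - q = q\<^sup>2 * (z - q) / d z" if z: "z \<in> R" for z
  proof -
    have "(z + a) - p * d z = p\<^sup>2 * (z - p)" "(z + a) - q * d z = q\<^sup>2 * (z - q)"
      using pq(2) unfolding ap d_def by algebra+
    then show "\<phi> z - p = p\<^sup>2 * (z - p) / d z" "\<phi> z - q = q\<^sup>2 * (z - q) / d z"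
      unfolding \<phi>(1)[OF z] using \<phi>(2)[OF z] by (simp_all add: field_simps)
  qed
  \<comment> \<open>The inverse branch. The inverse matrix has lower row (-a, 1) and determinant 1,
    which makes m the conformal factor.\<close>
  define \<psi> where "\<psi> z = ((1 + a\<^sup>2) * z - a) / (1 - a * z)" for z
  define m where "m z = 1 / (cmod (1 - a * z))\<^sup>2" for z
  have den: "1 - a * \<phi> z = 1 / d z" and \<psi>\<phi>: "\<psi> (\<phi> z) = z" if z: "z \<in> R" for z
  proof -
    show 1: "1 - a * \<phi> z = 1 / d z"
      unfolding \<phi>(1)[OF z] using \<phi>(2)[OF z] by (simp add: d_def field_simps power2_eq_square)
    have "(1 + a\<^sup>2) * \<phi> z - a = z / d z"
      unfolding \<phi>(1)[OF z] using \<phi>(2)[OF z] by (simp add: d_def field_simps power2_eq_square)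
    then show "\<psi> (\<phi> z) = z" unfolding \<psi>_def 1 using \<phi>(2)[OF z] by simp
  qed
  have \<phi>\<psi>: "\<phi> (\<psi> w) = w" if "1 - a * w \<noteq> 0" "\<psi> w \<in> R" for w
  proof -
    have "\<psi> w + a = w / (1 - a * w)" "d (\<psi> w) = 1 / (1 - a * w)"
      using that(1) by (simp_all add: \<psi>_def d_def field_simps power2_eq_square)
    then show ?thesis unfolding \<phi>(1)[OF that(2)] using that(1) by simp
  qed
  have inv: "act_SL2 (matrix_inv (h k)) (bdry w) = bdry (\<psi> w)" if "1 - a * w \<noteq> 0" for w
    unfolding hk matrix_inv_cf_matrix_square act_SL2_bdry
    using that by (simp add: moebius_map_def \<psi>_def algebra_simps)
  have ev: "\<forall>\<^sub>F w in nhds (\<phi> z). 1 - a * w \<noteq> 0" if z: "z \<in> R" for z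
  proof -
    have "open {w. 1 - a * w \<noteq> 0}" by (intro open_Collect_neq continuous_intros)
    moreover have "\<phi> z \<in> {w. 1 - a * w \<noteq> 0}"
      unfolding mem_Collect_eq den[OF z] using \<phi>(2)[OF z] by simp
    ultimately show ?thesis using eventually_nhds_in_open by fastforce
  qed
  have diff: "\<psi> differentiable (at w)" if "1 - a * w \<noteq> 0" for w
    unfolding \<psi>_def[abs_def] using that by (auto intro!: derivative_intros)
  have dist: "distortion act_SL2 h E ((card A)\<^sup>2) (bdry (\<phi> z))
      = ln ((cmod (q\<^sup>2))\<^sup>2 * (cmod (z - q) / cmod (\<phi> z - q))\<^sup>2 * (1 + (cmod (\<phi> z))\<^sup>2) / (1 + (cmod z)\<^sup>2))"
    if zU: "z \<in> interior R" for z
  proof -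
    have z: "z \<in> R" using zU interior_subset by blast
    have nz: "1 - a * \<phi> z \<noteq> 0" unfolding den[OF z] using \<phi>(2)[OF z] by simp
    \<comment> \<open>By continuity of \<psi>, points w near \<phi> z have \<psi> w in R, and w =
      \<phi> (\<psi> w) then lies in the cylinder.\<close>
    have "\<phi> z \<in> interior (E k)"
    proof (rule interior_if_eventually_nhds)
      have "isCont \<psi> (\<phi> z)" using diff[OF nz] by (auto simp: differentiable_def intro: has_derivative_continuous)
      then have "filterlim \<psi> (nhds z) (nhds (\<phi> z))"
        using \<psi>\<phi>[OF z] by (metis continuous_at tendsto_nhds_iff isCont_def)
      moreover have "\<forall>\<^sub>F w in nhds z. w \<in> interior R" using zU by (intro eventually_nhds_in_open) auto
      ultimately have "\<forall>\<^sub>F w in nhds (\<phi> z). \<psi> w \<in> interior R"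
        by (rule eventually_compose_filterlim[rotated])
      with ev[OF z] show "\<forall>\<^sub>F w in nhds (\<phi> z). w \<in> E k"
      proof eventually_elim
        case (elim w)
        then have w: "\<psi> w \<in> R" using interior_subset by blast
        have "w = 1 / (1 / (\<psi> w + a) + a)" using \<phi>\<psi>[OF elim(1) w] by (simp add: \<phi>_def)
        with w show ?case unfolding Ek by blast
      qed
    qed
    moreover have "isCont m (\<phi> z)" unfolding m_def using nz by (intro continuous_intros) auto
    moreover have "\<forall>\<^sub>F w in nhds (\<phi> z). (cmod (\<psi> w - \<psi> (\<phi> z)))\<^sup>2 = m w * m (\<phi> z) * (cmod (w - \<phi> z))\<^sup>2"
      using ev[OF z]
    proof eventually_elim
      case (elim w)
      have "\<psi> w - \<psi> v = (w - v) / ((1 - a * w) * (1 - a * v))" if "1 - a * v \<noteq> 0" for v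
        using elim that unfolding \<psi>_def
        by (simp add: diff_frac_eq) (simp add: algebra_simps power2_eq_square)
      from this[OF nz] show ?case
        by (simp add: m_def norm_divide norm_mult power_divide power_mult_distrib)
    qed
    moreover have "\<forall>\<^sub>F w in nhds (\<phi> z). act_SL2 (matrix_inv (h k)) (bdry w) = bdry (\<psi> w)"
      using ev[OF z] by eventually_elim (rule inv)
    ultimately have "distortion act_SL2 h E ((card A)\<^sup>2) (bdry (\<phi> z))
        = ln (m (\<phi> z) * (1 + (cmod (\<phi> z))\<^sup>2) / (1 + (cmod (\<psi> (\<phi> z)))\<^sup>2))"
      using k disjoint_cylinders diff[OF nz] nz
      by (intro distortion_of_inverse_branch) (auto simp: m_def)
    moreover have "m (\<phi> z) = (cmod (q\<^sup>2))\<^sup>2 * (cmod (z - q) / cmod (\<phi> z - q))\<^sup>2"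
      unfolding m_def den[OF z] \<phi>q[OF z] using \<phi>(2)[OF z] q0 z qR
      by (auto simp: norm_divide norm_mult power_divide power_mult_distrib)
    ultimately show ?thesis by (simp add: \<psi>\<phi>[OF z])
  qed
  have act\<phi>: "act_SL2 (h k) (bdry z) = bdry (\<phi> z)" if "z \<in> R" for z
    unfolding hk \<phi>_def by (intro act_two_steps a that)
  have "attracting_generator act_SL2 h E ((card A)\<^sup>2) k (interior R) p q \<phi> (cmod (p\<^sup>2) / cmod (q\<^sup>2)) ((cmod (q\<^sup>2))\<^sup>2)"
  proof
    show "q \<notin> interior R" using qR interior_subset by blast
    show "cmod (p\<^sup>2) / cmod (q\<^sup>2) < 1"
      using p1 q1 q0 by (simp add: norm_power power_strict_mono)
    fix z assume zU: "z \<in> interior R"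
    then have z: "z \<in> R" using interior_subset by blast
    show "\<phi> z \<in> interior R" by (rule \<phi>U[OF z])
    show "cmod (\<phi> z - p) * cmod (z - q) = cmod (p\<^sup>2) / cmod (q\<^sup>2) * cmod (\<phi> z - q) * cmod (z - p)"
      unfolding \<phi>p[OF z] \<phi>q[OF z] using q0 \<phi>(2)[OF z] by (simp add: norm_mult norm_divide)
    show "act_SL2 (word h (\<lambda>_. k) j) (bdry z) = bdry ((\<phi> ^^ Suc j) z)" for j
    proof (induction j)
      case (Suc j)
      have "(\<phi> ^^ Suc j) z \<in> R"
        by (induction j) (use \<phi>U z interior_subset in auto)
      then show ?case using act_SL2_mult_bdry[OF Suc, of "h k"] act\<phi> by simp
    qed (simp add: act\<phi>[OF z])
  qed (use q0 dist in auto)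
  \<comment> \<open>\<open>W n\<close> has eigenvector (p, 1) with eigenvalue q^(2 (n + 1)); the
    shift arises because \<open>word\<close> already has one factor at 0. Height and distance to p
    are each at most (1 + |p|^2) / |q|^(4 (n + 1)).\<close>
  moreover have "\<exists>x. act_SL2 (word h (\<lambda>_. k) n) base_pt = Some x \<and> snd x \<noteq> 0
      \<and> norm (x - (p, 0)) \<le> 2 * (1 + (cmod p)\<^sup>2) * (1 / (cmod q) ^ 4) ^ Suc n" for n
  proof -
    define W where "W n = word h (\<lambda>_. k) n" for n
    define l where "l n = (q\<^sup>2) ^ Suc n" for n
    have W: "det (W n) = 1 \<and> W n $ 1 $ 1 * p + W n $ 1 $ 2 = l n * p \<and> W n $ 2 $ 1 * p + W n $ 2 $ 2 = l n"
    proof (induction n)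
      case 0
      have "p + a = q\<^sup>2 * p" "a * p + (1 + a\<^sup>2) = q\<^sup>2"
        using pq(2) unfolding ap by algebra+
      then show ?case by (simp add: W_def l_def hk det_mul cf_matrix_square_entries)
    next
      case (Suc n)
      have W: "W (Suc n) = h k ** W n" by (simp add: W_def)
      have e: "(h k ** W n) $ i $ 1 * p + (h k ** W n) $ i $ 2 = l n * (h k $ i $ 1 * p + h k $ i $ 2)" for i
      proof -
        have "(h k ** W n) $ i $ 1 * p + (h k ** W n) $ i $ 2
            = h k $ i $ 1 * (W n $ 1 $ 1 * p + W n $ 1 $ 2) + h k $ i $ 2 * (W n $ 2 $ 1 * p + W n $ 2 $ 2)"
          by (simp add: matrix_matrix_mult_def sum_2 algebra_simps)
        also have "\<dots> = h k $ i $ 1 * (l n * p) + h k $ i $ 2 * l n"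
          using Suc by simp
        finally show ?thesis by (simp add: algebra_simps)
      qed
      have "p + a = q\<^sup>2 * p" "a * p + (1 + a\<^sup>2) = q\<^sup>2"
        using pq(2) unfolding ap by algebra+
      then show ?case unfolding W e using Suc
        by (simp add: hk det_mul cf_matrix_square_entries l_def mult_ac)
    qed
    obtain z t where zt: "act_SL2 (W n) base_pt = Some (z, t)" "t > 0"
      "t \<le> (1 + (cmod p)\<^sup>2) / (cmod (l n))\<^sup>2" "cmod (z - p) \<le> (1 + (cmod p)\<^sup>2) / (cmod (l n))\<^sup>2"
      using act_SL2_base_pt_near_fixed_point[where A = "W n" and p = p and l = "l n"] W by metis
    have l: "1 / (cmod (l n))\<^sup>2 = (1 / (cmod q) ^ 4) ^ Suc n"
      unfolding l_def norm_power power_divide power_mult[symmetric]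
      by (simp add: mult_ac power_add power4_eq_xxxx)
    have "norm ((z, t) - (p, 0)) \<le> cmod (z - p) + t"
      using zt(2) by (simp add: norm_Pair sqrt_sum_squares_le_sum)
    also have "\<dots> \<le> 2 * ((1 + (cmod p)\<^sup>2) / (cmod (l n))\<^sup>2)" using zt(3,4) by linarith
    also have "\<dots> = 2 * (1 + (cmod p)\<^sup>2) * (1 / (cmod q) ^ 4) ^ Suc n" by (simp only: l[symmetric]) simp
    finally show ?thesis using zt(1,2) by (intro exI[of _ "(z, t)"]) (simp add: W_def)
  qed
  then obtain x where x: "\<And>n. act_SL2 (word h (\<lambda>_. k) n) base_pt = Some (x n)" "\<And>n. snd (x n) \<noteq> 0"
      "\<And>n. norm (x n - (p, 0)) \<le> 2 * (1 + (cmod p)\<^sup>2) * (1 / (cmod q) ^ 4) ^ Suc n"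
    by metis
  have "(\<lambda>n. 2 * (1 + (cmod p)\<^sup>2) * (1 / (cmod q) ^ 4) ^ Suc n) \<longlonglongrightarrow> 0"
  proof (intro tendsto_mult_right_zero LIMSEQ_Suc LIMSEQ_power_zero)
    have "1 < cmod q ^ 4" using one_less_power[OF q1, of 4] by simp
    moreover from this have "0 < cmod q ^ 4" by linarith
    ultimately show "norm (1 / cmod q ^ 4) < 1" by (simp add: divide_less_eq_1)
  qed
  then have "(\<lambda>n. x n - (p, 0)) \<longlonglongrightarrow> 0"
    by (rule Lim_null_comparison[rotated]) (intro always_eventually allI x(3))
  then have "x \<longlonglongrightarrow> (p, 0)" by (simp add: LIM_zero_iff)
  moreover have "q * (q + a) = 1" using pq(2) unfolding qa by (simp add: mult.commute)
  ultimately show thesis using pU pE x(1,2) by (intro that) auto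
qed

theorem LNIC: "LNIC act_SL2 h E ((card A)\<^sup>2) cf_adm"
proof -
  obtain e where e: "bij_betw e {1..(card A)\<^sup>2} (A \<times> A)"
    "\<forall>j\<in>{1..(card A)\<^sup>2}. h j = cf_matrix (fst (e j)) ** cf_matrix (snd (e j))"
    "\<forall>j\<in>{1..(card A)\<^sup>2}. E j = (\<lambda>z. 1 / (1 / (z + snd (e j)) + fst (e j))) ` R"
    by (rule enumeration)
  obtain a b where ab: "a \<in> A" "b \<in> A" "a \<noteq> b" using two_letters by blast
  obtain k where k: "k \<in> {1..(card A)\<^sup>2}" "e k = (a, a)"
    using e(1) ab by (metis bij_betw_iff_bijections mem_Sigma_iff)
  obtain l where l: "l \<in> {1..(card A)\<^sup>2}" "e l = (b, b)"
    using e(1) ab by (metis bij_betw_iff_bijections mem_Sigma_iff)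
  obtain p q \<phi> \<kappa> C x where 1:
    "attracting_generator act_SL2 h E ((card A)\<^sup>2) k (interior R) p q \<phi> \<kappa> C"
    "p \<in> interior R" "p \<in> E k" "q * (q + a) = 1"
    "\<forall>n. act_SL2 (word h (\<lambda>_. k) n) base_pt = Some (x n) \<and> snd (x n) \<noteq> 0" "x \<longlonglongrightarrow> (p, 0)"
  proof (rule attracting_generator[OF ab(1) k(1)])
    show "h k = cf_matrix a ** cf_matrix a" "E k = (\<lambda>z. 1 / (1 / (z + a) + a)) ` R"
      using bspec[OF e(2) k(1)] bspec[OF e(3) k(1)] k(2) by simp_all
  qed (rule that)
  obtain p' q' \<phi>' \<kappa>' C' x' where 2:
    "attracting_generator act_SL2 h E ((card A)\<^sup>2) l (interior R) p' q' \<phi>' \<kappa>' C'"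
    "q' * (q' + b) = 1"
  proof (rule attracting_generator[OF ab(2) l(1)])
    show "h l = cf_matrix b ** cf_matrix b" "E l = (\<lambda>z. 1 / (1 / (z + b) + b)) ` R"
      using bspec[OF e(2) l(1)] bspec[OF e(3) l(1)] l(2) by simp_all
  qed (rule that)
  \<comment> \<open>The equation q (q + a) = 1 shows q \<noteq> 0 and recovers a from q.\<close>
  have "q \<noteq> q'"
  proof
    assume "q = q'"
    then have "q * (q + a) = q * (q + b)" "q \<noteq> 0" using 1(4) 2(2) by auto
    then show False using ab by simp
  qed
  then show ?thesis
    using LNIC_of_attracting_generators[OF 1(1) 2(1) k(1) l(1) _ _ _ 1(2,2,3) _ _ _ 1(6)] 1(5)
    by (simp add: cf_adm_def)
qed

end

section \<open>The action of Lorentz matrices\<close>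

text \<open>The polarization of \<open>quad_form\<close>.\<close>

definition lorentz_form :: "real^('m::finite option option) \<Rightarrow> real^('m option option) \<Rightarrow> real" where
  "lorentz_form x y = (\<Sum>i\<in>UNIV. x $ Some i * y $ Some i) - x $ None * y $ None"

lemma quad_form_eq_lorentz_form: "quad_form x = lorentz_form x x"
  by (simp add: quad_form_def lorentz_form_def power2_eq_square)

lemma lorentz_form_linear [simp]:
  "lorentz_form (x + y) z = lorentz_form x z + lorentz_form y z"
  "lorentz_form z (x + y) = lorentz_form z x + lorentz_form z y"
  "lorentz_form (c *\<^sub>R x) z = c * lorentz_form x z"
  "lorentz_form z (c *\<^sub>R x) = c * lorentz_form z x"
  by (simp_all add: lorentz_form_def algebra_simps sum.distrib sum_distrib_left)

lemma lorentz_form_commute: "lorentz_form x y = lorentz_form y x"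
  by (simp add: lorentz_form_def mult.commute)

lemma lorentz_form_preserved:
  assumes "\<And>x. quad_form (A *v x) = quad_form x"
  shows "lorentz_form (A *v x) (A *v y) = lorentz_form x y"
  using assms[of "x + y"] assms[of x] assms[of y] lorentz_form_commute[of y x]
    lorentz_form_commute[of "A *v y" "A *v x"]
  by (simp add: quad_form_eq_lorentz_form matrix_vector_right_distrib)

lemma sum_UNIV_option:
  "(\<Sum>i\<in>(UNIV :: 'm::finite option set). f i) = f None + (\<Sum>j\<in>UNIV. f (Some j))"
  by (simp add: UNIV_option_conv sum.reindex)

section \<open>Points of the closed half space as rays of the future cone\<close>

text \<open>Its rays are the points of the closed half space. The sign condition selects one half of
  the cone; it matters because \<open>cone_point\<close> is invariant under positive scalars only, a
  negative one reversing the height.\<close>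

definition future_cone :: "(real^('m::finite option option)) set" where
  "future_cone = {w. quad_form w \<le> 0 \<and> w $ None > 0}"

definition closed_half_space :: "(real^'m::finite) hpt set" where
  "closed_half_space = insert None {Some (x, y) | x y. y \<ge> 0}"

lemma cone_vector_nth [simp]:
  "cone_vector (Some (x, y)) $ Some (Some j) = 2 * x $ j"
  "cone_vector (Some (x, y)) $ Some None = 1 - (norm x)\<^sup>2 - y\<^sup>2"
  "cone_vector (Some (x, y)) $ None = 1 + (norm x)\<^sup>2 + y\<^sup>2"
  "cone_vector None $ Some (Some j) = 0"
  "cone_vector None $ Some None = - 1"
  "cone_vector None $ None = 1"
  by (simp_all add: cone_vector_def)

lemma sum_nth_square: "(\<Sum>j\<in>UNIV. (x $ j)\<^sup>2) = (norm (x :: real^'m::finite))\<^sup>2"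
  unfolding power2_norm_eq_inner inner_vec_def by (simp add: power2_eq_square)

text \<open>Turns invariance of the form into exact identities between Euclidean distances to
  boundary points, for boundary and interior points alike.\<close>

lemma lorentz_form_cone_vector:
  "lorentz_form (cone_vector (Some (x, y))) (cone_vector (bdry x')) = - 2 * (norm ((x, y) - (x', 0)))\<^sup>2"
proof -
  have "(\<Sum>j\<in>UNIV. 2 * x $ j * (2 * x' $ j)) = 4 * (x \<bullet> x')"
    by (simp add: inner_vec_def sum_distrib_left mult_ac)
  then have "lorentz_form (cone_vector (Some (x, y))) (cone_vector (bdry x'))
     = (1 - (norm x)\<^sup>2 - y\<^sup>2) * (1 - (norm x')\<^sup>2) + 4 * (x \<bullet> x')
       - (1 + (norm x)\<^sup>2 + y\<^sup>2) * (1 + (norm x')\<^sup>2)"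
    by (simp add: lorentz_form_def sum_UNIV_option bdry_def)
  also have "\<dots> = - 2 * ((norm (x - x'))\<^sup>2 + y\<^sup>2)"
    by (simp add: power2_norm_eq_inner inner_diff inner_commute algebra_simps)
  finally show ?thesis by (simp add: norm_Pair)
qed

lemma quad_form_cone_vector: "quad_form (cone_vector (Some (x, y))) = - 4 * y\<^sup>2"
proof -
  have "quad_form (cone_vector (Some (x, y)))
     = (1 - (norm x)\<^sup>2 - y\<^sup>2)\<^sup>2 + 4 * (norm x)\<^sup>2 - (1 + (norm x)\<^sup>2 + y\<^sup>2)\<^sup>2"
    by (simp add: quad_form_def sum_UNIV_option power_mult_distrib sum_nth_square flip: sum_distrib_left)
  then show ?thesis by (simp add: power2_eq_square algebra_simps)
qed

lemma quad_form_cone_vector_None: "quad_form (cone_vector None) = 0"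
  by (simp add: quad_form_def sum_UNIV_option)

lemma quad_form_cone_vector_boundary: "p \<in> boundary \<Longrightarrow> quad_form (cone_vector p) = 0"
  by (auto simp: boundary_def bdry_def quad_form_cone_vector quad_form_cone_vector_None)

lemma cone_vector_future: "p \<in> closed_half_space \<Longrightarrow> cone_vector p \<in> future_cone"
  by (auto simp: closed_half_space_def future_cone_def quad_form_cone_vector quad_form_cone_vector_None
      add_pos_nonneg)

lemma quad_form_scaleR: "quad_form (c *\<^sub>R w) = c\<^sup>2 * quad_form w"
  by (simp add: quad_form_eq_lorentz_form power2_eq_square)

lemma cone_point_scaleR:
  assumes "c > 0"
  shows "cone_point (c *\<^sub>R w) = cone_point w"
proof -
  have "sqrt (- quad_form (c *\<^sub>R w)) = c * sqrt (- quad_form w)"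
    using assms real_sqrt_mult[of "c\<^sup>2" "- quad_form w"] by (simp add: quad_form_scaleR)
  moreover have "(c *\<^sub>R w) $ Some None + (c *\<^sub>R w) $ None = c * (w $ Some None + w $ None)"
    by (simp add: algebra_simps)
  ultimately show ?thesis using assms
    unfolding cone_point_def Let_def by (simp add: vec_eq_iff)
qed

lemma cone_point_cone_vector:
  assumes "p \<in> closed_half_space"
  shows "cone_point (cone_vector p) = p"
proof (cases p)
  case None
  then show ?thesis by (simp add: cone_point_def Let_def)
next
  case (Some P)
  obtain x y where P: "P = (x, y)" by fastforce
  with Some assms have y: "y \<ge> 0" by (simp add: closed_half_space_def)
  then have "sqrt (4 * y\<^sup>2) = 2 * y" by (simp add: real_sqrt_mult)
  then show ?thesis
    by (simp add: Some P cone_point_def Let_def quad_form_cone_vector vec_eq_iff)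
qed

text \<open>For finite points the coordinates \<open>Some None\<close> and \<open>None\<close> of
  \<open>cone_vector\<close> add up to 2, so the scale is half the sum s. On the cone s is
  nonnegative and vanishes only on the ray of \<infinity>, where the scale is left
  unspecified.\<close>

lemma future_cone_decomposition:
  assumes "w \<in> future_cone"
  shows "cone_point w \<in> closed_half_space"
    and "\<exists>c>0. w = c *\<^sub>R cone_vector (cone_point w)
      \<and> (w $ Some None + w $ None \<noteq> 0 \<longrightarrow> c = (w $ Some None + w $ None) / 2)"
proof -
  define s where "s = w $ Some None + w $ None"
  define S where "S = (\<Sum>j\<in>UNIV. (w $ Some (Some j))\<^sup>2)"
  have Q: "quad_form w = (w $ Some None)\<^sup>2 + S - (w $ None)\<^sup>2"
    by (simp add: quad_form_def sum_UNIV_option S_def)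
  have S: "S \<ge> 0" unfolding S_def by (intro sum_nonneg) simp
  have Qle: "quad_form w \<le> 0" and N: "w $ None > 0" using assms by (auto simp: future_cone_def)
  have "\<bar>w $ Some None\<bar> \<le> \<bar>w $ None\<bar>"
    unfolding abs_le_square_iff using Qle Q S by linarith
  then have s0: "s \<ge> 0" using N by (simp add: s_def)
  have "cone_point w \<in> closed_half_space \<and> (\<exists>c>0. w = c *\<^sub>R cone_vector (cone_point w) \<and> (s \<noteq> 0 \<longrightarrow> c = s / 2))"
  proof (cases "s = 0")
    case True
    then have SN: "w $ Some None = - w $ None" by (simp add: s_def)
    then have "S = 0" using Q Qle S by simp
    then have "w $ Some (Some j) = 0" for j
      unfolding S_def by (subst (asm) sum_nonneg_eq_0_iff) auto
    then have "w = (w $ None) *\<^sub>R cone_vector None"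
      using SN by (auto simp: vec_eq_iff split_option_all)
    then show ?thesis using True N
      by (intro conjI exI[of _ "w $ None"]) (auto simp: cone_point_def s_def closed_half_space_def)
  next
    case False
    with s0 have s: "s > 0" by simp
    define x where "x = (\<chi> j. w $ Some (Some j) / s)"
    define y where "y = sqrt (- quad_form w) / s"
    have cp: "cone_point w = Some (x, y)" using False by (simp add: cone_point_def x_def y_def s_def Let_def)
    have y0: "y \<ge> 0" using s Qle by (simp add: y_def)
    have "(norm x)\<^sup>2 + y\<^sup>2 = (S - quad_form w) / s\<^sup>2"
    proof -
      have "(norm x)\<^sup>2 = S / s\<^sup>2"
        by (simp add: x_def S_def power_divide sum_divide_distrib flip: sum_nth_square)
      moreover have "y\<^sup>2 = - quad_form w / s\<^sup>2" using Qle by (simp add: y_def power_divide)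
      ultimately show ?thesis by (simp add: diff_divide_distrib)
    qed
    also have "S - quad_form w = (w $ None - w $ Some None) * s"
      unfolding Q s_def by (simp add: power2_eq_square algebra_simps)
    finally have xy: "s * ((norm x)\<^sup>2 + y\<^sup>2) = w $ None - w $ Some None"
      using s by (simp add: power2_eq_square)
    have "(s / 2) * (1 + (norm x)\<^sup>2 + y\<^sup>2) = (s + s * ((norm x)\<^sup>2 + y\<^sup>2)) / 2"
      by (simp add: field_simps)
    then have N': "(s / 2) * (1 + (norm x)\<^sup>2 + y\<^sup>2) = w $ None"
      unfolding xy by (simp add: s_def)
    have "(s / 2) * (1 - (norm x)\<^sup>2 - y\<^sup>2) = (s - s * ((norm x)\<^sup>2 + y\<^sup>2)) / 2"
      by (simp add: field_simps)
    then have SN': "(s / 2) * (1 - (norm x)\<^sup>2 - y\<^sup>2) = w $ Some None"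
      unfolding xy by (simp add: s_def)
    have "w $ i = ((s / 2) *\<^sub>R cone_vector (Some (x, y))) $ i" for i
    proof (cases i)
      case None
      then show ?thesis using N' by simp
    next
      case (Some k)
      then show ?thesis using SN' s by (cases k) (simp_all add: x_def)
    qed
    then have "w = (s / 2) *\<^sub>R cone_vector (Some (x, y))" by (simp add: vec_eq_iff)
    then show ?thesis using s y0 cp
      by (intro conjI exI[of _ "s / 2"]) (auto simp: closed_half_space_def)
  qed
  then show "cone_point w \<in> closed_half_space"
    "\<exists>c>0. w = c *\<^sub>R cone_vector (cone_point w)
      \<and> (w $ Some None + w $ None \<noteq> 0 \<longrightarrow> c = (w $ Some None + w $ None) / 2)"
    by (auto simp: s_def)
qed

section \<open>Lorentz matrices preserving the future cone\<close>

text \<open>A substitute for the identity component with explicit conditions: closure under products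
  and inverses reduces to the sign of one entry.\<close>

definition orthochronous :: "(real^('m::finite option option)^('m option option)) set" where
  "orthochronous = {A. (\<forall>x. quad_form (A *v x) = quad_form x) \<and> A $ None $ None > 0}"

lemma orthochronousD:
  "A \<in> orthochronous \<Longrightarrow> quad_form (A *v x) = quad_form x"
  "A \<in> orthochronous \<Longrightarrow> lorentz_form (A *v x) (A *v y) = lorentz_form x y"
  by (auto simp: orthochronous_def lorentz_form_preserved)

lemma matrix_axis_None:
  "(A *v axis None 1) $ None = (A :: real^('m::finite option option)^('m option option)) $ None $ None"
  by (simp add: matrix_vector_mul_component inner_axis)

lemma lorentz_form_axis_None: "lorentz_form (axis None 1) w = - w $ None"
  by (simp add: lorentz_form_def axis_def)

lemma axis_None_future: "axis None 1 \<in> future_cone"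
  by (simp add: future_cone_def quad_form_eq_lorentz_form lorentz_form_axis_None )

text \<open>The spatial norms U and W are bounded by the absolute time coordinates, so by
  Cauchy-Schwarz the spatial part of the form cannot outweigh the time part.\<close>

lemma lorentz_form_future:
  assumes "quad_form u < 0" "u $ None > 0" "quad_form w \<le> 0" "w $ None \<le> 0"
  shows "lorentz_form u w \<ge> 0"
proof -
  define U W where "U = sqrt (\<Sum>i\<in>UNIV. (u $ Some i)\<^sup>2)" and "W = sqrt (\<Sum>i\<in>UNIV. (w $ Some i)\<^sup>2)"
  have "U\<^sup>2 = quad_form u + (u $ None)\<^sup>2" "W\<^sup>2 = quad_form w + (w $ None)\<^sup>2"
    by (simp_all add: U_def W_def quad_form_def sum_nonneg)
  then have "U\<^sup>2 \<le> (u $ None)\<^sup>2" "W\<^sup>2 \<le> (- w $ None)\<^sup>2"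
    using assms by simp_all
  then have "U \<le> u $ None" "W \<le> - w $ None"
    using assms by (simp_all only: power2_le_imp_le less_imp_le neg_0_le_iff_le)
  moreover have "0 \<le> W" "0 \<le> U" by (auto simp: W_def U_def sum_nonneg)
  ultimately have "U * W \<le> u $ None * (- w $ None)"
    by (intro mult_mono) (use assms in auto)
  moreover have "\<bar>\<Sum>i\<in>UNIV. u $ Some i * w $ Some i\<bar> \<le> U * W"
  proof -
    have "\<bar>(\<chi> i. u $ Some i) \<bullet> (\<chi> i. w $ Some i)\<bar> \<le> norm (\<chi> i. u $ Some i) * norm (\<chi> i. w $ Some i)"
      by (rule Cauchy_Schwarz_ineq2)
    then show ?thesis by (simp add: inner_vec_def norm_vec_def L2_set_def U_def W_def)
  qed
  ultimately show ?thesis by (simp add: lorentz_form_def)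
qed

text \<open>With e the time axis, a nonpositive time coordinate of A w would make the form of A e
  and A w nonnegative, yet it equals the form of e and w, which is minus the time coordinate of
  w.\<close>

lemma orthochronous_future:
  assumes A: "A \<in> orthochronous" and w: "w \<in> future_cone"
  shows "A *v w \<in> future_cone"
proof -
  have "(A *v w) $ None > 0"
  proof (rule ccontr)
    assume "\<not> ?thesis"
    moreover have "quad_form (A *v axis None 1) < 0"
      by (simp add: orthochronousD(1)[OF A]) (simp add: quad_form_eq_lorentz_form lorentz_form_axis_None)
    ultimately have "lorentz_form (A *v axis None 1) (A *v w) \<ge> 0"
      using A w by (intro lorentz_form_future)
        (auto simp: matrix_axis_None orthochronousD(1)[OF A] orthochronous_def future_cone_def)
    then show False using w
      by (simp add: orthochronousD(2)[OF A] lorentz_form_axis_None future_cone_def)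
  qed
  then show ?thesis using w by (simp add: future_cone_def orthochronousD(1)[OF A])
qed

lemma orthochronous_mult:
  assumes "A \<in> orthochronous" "B \<in> orthochronous"
  shows "A ** B \<in> orthochronous"
proof -
  have "(A *v (B *v axis None 1)) $ None > 0"
    using orthochronous_future[OF assms(1) orthochronous_future[OF assms(2) axis_None_future]]
    by (simp add: future_cone_def)
  then have "(A ** B) $ None $ None > 0"
    by (simp add: matrix_vector_mul_assoc matrix_axis_None)
  then show ?thesis using assms
    by (simp add: orthochronous_def flip: matrix_vector_mul_assoc)
qed

text \<open>For the sign, the form of e and B e equals that of A e and e, and each is minus a time
  coordinate.\<close>

lemma orthochronous_inverse:
  assumes A: "A \<in> orthochronous" and B: "A ** B = mat 1"
  shows "B \<in> orthochronous"
proof -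
  have AB: "A *v (B *v x) = x" for x by (simp add: matrix_vector_mul_assoc B)
  have q: "quad_form (B *v x) = quad_form x" for x
    using orthochronousD(1)[OF A, of "B *v x"] by (simp add: AB)
  have "(B *v axis None 1) $ None > 0"
  proof (rule ccontr)
    let ?v = "B *v axis None 1"
    assume n: "\<not> ?thesis"
    have "lorentz_form (A *v axis None 1) (A *v ?v) = - (A *v axis None 1) $ None"
      unfolding AB using lorentz_form_commute lorentz_form_axis_None by metis
    then have "lorentz_form (axis None 1) ?v < 0"
      using A unfolding orthochronousD(2)[OF A] by (simp add: matrix_axis_None orthochronous_def)
    then show False using n by (simp add: lorentz_form_axis_None)
  qed
  then show ?thesis using q by (simp add: orthochronous_def matrix_axis_None)
qed

lemma act_SO_closed_half_space:
  assumes "A \<in> orthochronous" "p \<in> closed_half_space"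
  shows "act_SO A p \<in> closed_half_space"
  unfolding act_SO_def by (intro future_cone_decomposition orthochronous_future cone_vector_future assms)

lemma cone_vector_act_SO:
  assumes "A \<in> orthochronous" "p \<in> closed_half_space"
  obtains c where "c > 0" "A *v cone_vector p = c *\<^sub>R cone_vector (act_SO A p)"
  using future_cone_decomposition(2)[OF orthochronous_future[OF assms(1) cone_vector_future[OF assms(2)]]]
  unfolding act_SO_def by blast

lemma act_SO_mult:
  assumes "A \<in> orthochronous" "B \<in> orthochronous" "p \<in> closed_half_space"
  shows "act_SO (A ** B) p = act_SO A (act_SO B p)"
proof -
  obtain c where c: "c > 0" "B *v cone_vector p = c *\<^sub>R cone_vector (act_SO B p)"
    using cone_vector_act_SO[OF assms(2,3)] by blast
  show ?thesis unfolding act_SO_def[of "A ** B"] act_SO_def[of A]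
    using c by (simp add: cone_point_scaleR matrix_vector_mult_scaleR flip: matrix_vector_mul_assoc)
qed

lemma act_SO_mat_1: "p \<in> closed_half_space \<Longrightarrow> act_SO (mat 1) p = p"
  by (simp add: act_SO_def cone_point_cone_vector)

lemma boundary_subset_closed_half_space: "boundary \<subseteq> closed_half_space"
  by (auto simp: boundary_def bdry_def closed_half_space_def)

lemma bdry_in_closed_half_space [simp]: "bdry x \<in> closed_half_space"
  by (auto simp: bdry_def closed_half_space_def)

lemma act_SO_boundary:
  assumes A: "A \<in> orthochronous" and p: "p \<in> boundary"
  shows "act_SO A p \<in> boundary"
proof -
  have p': "p \<in> closed_half_space" using p boundary_subset_closed_half_space by blast
  obtain c where c: "c > 0" "A *v cone_vector p = c *\<^sub>R cone_vector (act_SO A p)"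
    using cone_vector_act_SO[OF A p'] by blast
  then have "c\<^sup>2 * quad_form (cone_vector (act_SO A p)) = 0"
    using orthochronousD(1)[OF A, of "cone_vector p"] quad_form_cone_vector_boundary[OF p]
    by (simp add: quad_form_scaleR)
  then have "quad_form (cone_vector (act_SO A p)) = 0" using c(1) by simp
  then show ?thesis
    by (cases "act_SO A p") (auto simp: boundary_def bdry_def quad_form_cone_vector)
qed

text \<open>The image of the time axis has Q = -1, whereas a vector with vanishing time coordinate
  has Q \<ge> 0.\<close>

lemma SO_Q_nth_None_nonzero:
  assumes "A \<in> SO_Q"
  shows "A $ None $ None \<noteq> 0"
proof
  assume "A $ None $ None = 0"
  then have "quad_form (A *v axis None 1) \<ge> 0"
    by (simp add: quad_form_def matrix_axis_None sum_nonneg)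
  moreover have "quad_form (A *v axis None 1) = - 1"
    using assms by (simp add: SO_Q_def) (simp add: quad_form_eq_lorentz_form lorentz_form_axis_None)
  ultimately show False by simp
qed

text \<open>The corner entry is continuous, never zero on \<open>SO_Q\<close> and equal to 1 at the
  identity, hence positive on a connected set containing the identity.\<close>

lemma SO_Q_identity_component_orthochronous: "SO_Q_identity_component \<subseteq> orthochronous"
proof
  fix A :: "real^('m::finite option option)^('m option option)"
  assume A: "A \<in> SO_Q_identity_component"
  let ?f = "\<lambda>A :: real^('m option option)^('m option option). A $ None $ None"
  let ?C = "SO_Q_identity_component :: (real^('m option option)^('m option option)) set"
  have sub: "?C \<subseteq> SO_Q" unfolding SO_Q_identity_component_def by (rule connected_component_subset)
  have "mat 1 \<in> (SO_Q :: (real^('m option option)^('m option option)) set)"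
    by (simp add: SO_Q_def)
  then have 1: "mat 1 \<in> ?C"
    unfolding SO_Q_identity_component_def by (simp add: connected_component_refl)
  have "connected (?f ` ?C)"
    unfolding SO_Q_identity_component_def
    by (intro connected_continuous_image connected_connected_component continuous_intros)
  moreover have "1 \<in> ?f ` ?C" using imageI[OF 1, of ?f] by (simp add: mat_def)
  moreover have "0 \<notin> ?f ` ?C"
  proof
    assume "0 \<in> ?f ` ?C"
    then obtain B where "0 = ?f B" "B \<in> ?C" by (rule imageE)
    then show False using subsetD[OF sub] SO_Q_nth_None_nonzero[of B] by simp
  qed
  moreover have "?f A \<in> ?f ` ?C" using A by (rule imageI)
  ultimately have "\<not> ?f A \<le> 0"
    using connectedD_interval[of "?f ` ?C" "?f A" 1 0] by (intro notI) simp
  then show "A \<in> orthochronous" using sub A by (auto simp: SO_Q_def orthochronous_def)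
qed

section \<open>Boosts and hyperbolic elements\<close>

text \<open>Hyperbolic rotation in the plane of one spatial axis and the time axis. Boosts serve to
  show that the identity component is not commutative.\<close>

definition boost_map :: "'m::finite option \<Rightarrow> real \<Rightarrow> real^('m option option) \<Rightarrow> real^('m option option)" where
  "boost_map i t x = (\<chi> k. if k = Some i then cosh t * x $ Some i + sinh t * x $ None
      else if k = None then sinh t * x $ Some i + cosh t * x $ None else x $ k)"

definition boost :: "'m::finite option \<Rightarrow> real \<Rightarrow> real^('m option option)^('m option option)" where
  "boost i t = matrix (boost_map i t)"

definition reflection :: "'m::finite option \<Rightarrow> real^('m option option)^('m option option)" where
  "reflection i = matrix (\<lambda>x. \<chi> k. if k = Some i then - x $ k else x $ k)"

lemma boost_vector: "boost i t *v x = boost_map i t x"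
proof -
  have "linear (boost_map i t)"
    by (rule linearI) (simp_all add: boost_map_def vec_eq_iff algebra_simps)
  then show ?thesis unfolding boost_def by (rule fun_cong[OF matrix_vector_mul(2)])
qed

lemma reflection_vector: "reflection i *v x = (\<chi> k. if k = Some i then - x $ k else x $ k)"
proof -
  have "linear (\<lambda>x::real^('a option option). \<chi> k. if k = Some i then - x $ k else x $ k)"
    by (rule linearI) (simp_all add: vec_eq_iff)
  then show ?thesis unfolding reflection_def by (rule fun_cong[OF matrix_vector_mul(2)])
qed

lemma boost_add: "boost i s ** boost i t = boost i (s + t)"
  unfolding matrix_eq
  by (simp add: boost_vector boost_map_def vec_eq_iff cosh_add sinh_add algebra_simps
      flip: matrix_vector_mul_assoc)

lemma boost_0: "boost i 0 = mat 1"
  unfolding matrix_eq by (simp add: boost_vector boost_map_def vec_eq_iff)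

lemma reflection_boost: "reflection i ** boost i t ** reflection i = boost i (- t)"
  unfolding matrix_eq
  by (simp add: boost_vector boost_map_def reflection_vector vec_eq_iff flip: matrix_vector_mul_assoc)

lemma reflection_reflection: "reflection i ** reflection i = mat 1"
  unfolding matrix_eq
  by (simp add: reflection_vector vec_eq_iff flip: matrix_vector_mul_assoc)

text \<open>The determinant of a boost is a square because a boost has a square root, and it is its own
  inverse because the boosts with parameters \<open>t\<close> and \<open>- t\<close> are conjugate.\<close>

lemma det_boost: "det (boost i t) = 1"
proof -
  have "det (boost i (t / 2)) * det (boost i (t / 2)) = det (boost i t)"
    unfolding det_mul[symmetric] boost_add by simp
  then have pos: "det (boost i t) \<ge> 0" by (metis zero_le_square)
  have "det (boost i (- t)) = det (reflection i ** reflection i) * det (boost i t)"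
    unfolding reflection_boost[symmetric] det_mul by simp
  then have "det (boost i (- t)) = det (boost i t)" by (simp add: reflection_reflection)
  moreover have "det (boost i t) * det (boost i (- t)) = 1"
    unfolding det_mul[symmetric] boost_add by (simp add: boost_0)
  ultimately have "(det (boost i t))\<^sup>2 = 1" by (simp add: power2_eq_square)
  then show ?thesis using pos by (simp add: power2_eq_1_iff)
qed

lemma quad_form_boost: "quad_form (boost i t *v x) = quad_form x"
proof -
  have s: "(\<Sum>k\<in>UNIV. f k) = f i + (\<Sum>k\<in>UNIV - {i}. f k)" for f :: "'a option \<Rightarrow> real"
    by (rule sum.remove) auto
  have "cosh t * cosh t = 1 + sinh t * sinh t"
    using hyperbolic_pythagoras[of t] by (simp add: power2_eq_square)
  then have "(cosh t * x $ Some i + sinh t * x $ None)\<^sup>2 - (sinh t * x $ Some i + cosh t * x $ None)\<^sup>2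
      = (x $ Some i)\<^sup>2 - (x $ None)\<^sup>2"
    unfolding power2_eq_square by algebra
  moreover have "(\<Sum>k\<in>UNIV - {i}. ((boost i t *v x) $ Some k)\<^sup>2) = (\<Sum>k\<in>UNIV - {i}. (x $ Some k)\<^sup>2)"
    by (intro sum.cong) (auto simp: boost_vector boost_map_def)
  ultimately show ?thesis
    unfolding quad_form_def s by (simp add: boost_vector boost_map_def)
qed

lemma boost_in_identity_component: "boost i t \<in> SO_Q_identity_component"
proof -
  have "continuous_on UNIV (\<lambda>t. boost i t $ k $ l)" for k l
  proof -
    consider "k = Some i" | "k = None" | "k \<noteq> Some i \<and> k \<noteq> None" by blast
    then show ?thesis
      by cases (auto simp: boost_def matrix_def boost_map_def simp del: not_None_eq intro!: continuous_intros)
  qed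
  then have "continuous_on UNIV (\<lambda>t. \<chi> k l. boost i t $ k $ l)"
    by (intro continuous_on_vec_lambda)
  then have "connected (range (boost i))"
    by (intro connected_continuous_image) simp_all
  moreover have "range (boost i) \<subseteq> SO_Q"
    by (auto simp: SO_Q_def det_boost quad_form_boost)
  moreover have "mat 1 \<in> range (boost i)" by (metis boost_0 rangeI)
  ultimately have "range (boost i) \<subseteq> SO_Q_identity_component"
    unfolding SO_Q_identity_component_def by (intro connected_component_maximal)
  then show ?thesis by blast
qed

text \<open>Applied to the time axis, the two products have i-th coordinates sinh 1 cosh 1 and sinh
  1.\<close>

lemma boosts_do_not_commute:
  assumes "i \<noteq> j"
  shows "boost i 1 ** boost j 1 \<noteq> boost j 1 ** boost i 1"
proof
  assume "boost i 1 ** boost j 1 = boost j 1 ** boost i 1"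
  then have "boost i 1 *v (boost j 1 *v axis None 1) = boost j 1 *v (boost i 1 *v axis None 1)"
    by (simp add: matrix_vector_mul_assoc)
  from arg_cong[OF this, of "\<lambda>x. x $ Some i"]
  have "sinh 1 * cosh (1::real) = sinh 1"
    using assms by (simp add: boost_vector boost_map_def axis_def)
  then show False using cosh_real_nonneg_less_iff[of 0 1] by simp
qed

lemma SO_Q_identity_component_not_commutative:
  "\<exists>A\<in>(SO_Q_identity_component :: (real^('m::finite option option)^('m option option)) set).
    \<exists>B\<in>SO_Q_identity_component. A ** B \<noteq> B ** A"
  using boosts_do_not_commute[of None "Some (undefined :: 'm)"] boost_in_identity_component by blast

section \<open>Eigenvectors at the fixed points of a hyperbolic element\<close>

lemma matrix_inv_inverse:
  fixes A :: "real^'n^'n"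
  assumes "det A \<noteq> 0"
  shows "A ** matrix_inv A = mat 1" "matrix_inv A ** A = mat 1"
proof -
  obtain B where "A ** B = mat 1" "B ** A = mat 1"
    using assms unfolding invertible_det_nz[symmetric] invertible_def by blast
  moreover from matrix_inv_eqI[OF this] have "matrix_inv A = B" .
  ultimately show "A ** matrix_inv A = mat 1" "matrix_inv A ** A = mat 1" by auto
qed

lemma cone_vector_eigenvector:
  assumes A: "A \<in> orthochronous" and x: "act_SO A (bdry x) = bdry x"
  obtains c where "c > 0" "A *v cone_vector (bdry x) = c *\<^sub>R cone_vector (bdry x)"
  using cone_vector_act_SO[OF A bdry_in_closed_half_space[of x]] x by metis

text \<open>Fixed boundary points are null eigenvectors with positive eigenvalues c and d. Their
  pairing is nonzero and invariant, so c d = 1; p is the one with the larger eigenvalue. Equality c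
  = d = 1 would produce a fixed point inside H^n.\<close>

lemma hyperbolic_eigenvectors:
  assumes A: "A \<in> orthochronous" and x: "act_SO A (bdry x) = bdry x" "act_SO A (bdry y) = bdry y" "x \<noteq> y"
    and interior: "\<And>z t. t > 0 \<Longrightarrow> act_SO A (Some (z, t)) \<noteq> Some (z, t)"
  obtains p q l where "{p, q} = {x, y}" "p \<noteq> q" "l > 1"
    "A *v cone_vector (bdry p) = l *\<^sub>R cone_vector (bdry p)"
    "A *v cone_vector (bdry q) = (1 / l) *\<^sub>R cone_vector (bdry q)"
proof -
  let ?v = "\<lambda>x. cone_vector (bdry x)"
  obtain c where c: "c > 0" "A *v ?v x = c *\<^sub>R ?v x"
    by (rule cone_vector_eigenvector[OF A x(1)])
  obtain d where d: "d > 0" "A *v ?v y = d *\<^sub>R ?v y"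
    by (rule cone_vector_eigenvector[OF A x(2)])
  have xy: "lorentz_form (?v x) (?v y) < 0"
    using x(3) lorentz_form_cone_vector[of x 0 y] by (simp add: bdry_def[of x])
  have "c * d * lorentz_form (?v x) (?v y) = lorentz_form (?v x) (?v y)"
    using orthochronousD(2)[OF A, of "?v x" "?v y"] by (simp add: c(2) d(2) mult_ac)
  then have cd: "c * d = 1" using xy by simp
  have "c \<noteq> 1"
  proof
    assume c1: "c = 1"
    \<comment> \<open>The sum of two non-proportional null vectors of the future cone is timelike;
      its ray is a point of the geodesic joining x and y.\<close>
    define w where "w = ?v x + ?v y"
    have "d = 1" using cd c1 by simp
    then have Aw: "A *v w = w" using c(2) d(2) c1 by (simp add: w_def matrix_vector_right_distrib)
    have null: "quad_form (?v z) = 0" for z by (simp add: bdry_def quad_form_cone_vector)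
    have Q: "quad_form w < 0"
      using xy null[of x] null[of y] lorentz_form_commute[of "?v x" "?v y"]
      by (simp add: w_def quad_form_eq_lorentz_form)
    have "?v x \<in> future_cone" "?v y \<in> future_cone" by (simp_all add: cone_vector_future)
    then have "w \<in> future_cone" using Q by (simp add: future_cone_def w_def)
    from future_cone_decomposition[OF this] obtain b where
      b: "cone_point w \<in> closed_half_space" "b > 0" "w = b *\<^sub>R cone_vector (cone_point w)" by blast
    have "quad_form w = b\<^sup>2 * quad_form (cone_vector (cone_point w))"
      using b(3) quad_form_scaleR by metis
    then have "cone_point w \<notin> boundary"
      using Q quad_form_cone_vector_boundary[of "cone_point w"] by auto
    then obtain z t where zt: "cone_point w = Some (z, t)" "t > 0"
      using b(1) by (force simp: boundary_def bdry_def closed_half_space_def image_iff)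
    have "act_SO A (cone_point w) = cone_point (b *\<^sub>R (A *v cone_vector (cone_point w)))"
      using b(2) by (simp add: act_SO_def cone_point_scaleR)
    also have "b *\<^sub>R (A *v cone_vector (cone_point w)) = w"
      using b(3) Aw by (metis matrix_vector_mult_scaleR)
    finally show False using interior[OF zt(2)] zt(1) by simp
  qed
  then consider "c > 1" | "d > 1"
    using cd c(1) d(1) by (metis linorder_neqE_linordered_idom mult.right_neutral mult_less_cancel_left_pos)
  then show thesis
  proof cases
    case 1
    have "d = 1 / c" using cd c(1) by (simp add: field_simps)
    with 1 c d x(3) that[of x y c] show ?thesis by simp
  next
    case 2
    have "c = 1 / d" using cd d(1) by (simp add: field_simps)
    with 2 c d x(3) that[of y x d] show ?thesis by (simp add: insert_commute)
  qed
qed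

text \<open>Pairing A X with the two eigenvectors gives relations P and Q containing the unknown
  scale c of the image; c drops out of their quotient. Points of positive height are included, so
  the orbit of o is covered too.\<close>

lemma act_SO_ratio_contraction:
  assumes A: "A \<in> orthochronous" and l: "l > 0"
    and p: "A *v cone_vector (bdry p) = l *\<^sub>R cone_vector (bdry p)"
    and q: "A *v cone_vector (bdry q) = (1 / l) *\<^sub>R cone_vector (bdry q)"
    and X: "snd X \<ge> 0" "act_SO A (Some X) = Some Y"
  shows "norm (Y - (p, 0)) * norm (X - (q, 0)) = (1 / l) * norm (Y - (q, 0)) * norm (X - (p, 0))"
    and "X \<noteq> (q, 0) \<Longrightarrow> Y \<noteq> (q, 0)"
proof -
  have Xc: "Some X \<in> closed_half_space" using X(1) by (cases X) (simp add: closed_half_space_def)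
  obtain c where c: "c > 0" "A *v cone_vector (Some X) = c *\<^sub>R cone_vector (Some Y)"
    using cone_vector_act_SO[OF A Xc] X(2) by metis
  have f: "lorentz_form (cone_vector (Some Z)) (cone_vector (bdry z)) = - 2 * (norm (Z - (z, 0)))\<^sup>2" for Z z
    using lorentz_form_cone_vector[of "fst Z" "snd Z" z] by simp
  have P: "c * l * (norm (Y - (p, 0)))\<^sup>2 = (norm (X - (p, 0)))\<^sup>2"
    using orthochronousD(2)[OF A, of "cone_vector (Some X)" "cone_vector (bdry p)"]
    by (simp add: c(2) p f mult_ac)
  have Q: "c * (norm (Y - (q, 0)))\<^sup>2 = l * (norm (X - (q, 0)))\<^sup>2"
    using orthochronousD(2)[OF A, of "cone_vector (Some X)" "cone_vector (bdry q)"] l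
    by (simp add: c(2) q f field_simps)
  have "c * l * ((norm (Y - (p, 0)))\<^sup>2 * (norm (X - (q, 0)))\<^sup>2)
      = (norm (X - (p, 0)))\<^sup>2 * (norm (X - (q, 0)))\<^sup>2"
    unfolding P[symmetric] by simp
  also have "\<dots> * l\<^sup>2 = c * l * ((norm (Y - (q, 0)))\<^sup>2 * (norm (X - (p, 0)))\<^sup>2)"
    using Q by (simp add: power2_eq_square mult_ac)
  finally have "c * l * (l * (norm (Y - (p, 0)) * norm (X - (q, 0))))\<^sup>2
      = c * l * (norm (Y - (q, 0)) * norm (X - (p, 0)))\<^sup>2"
    by (simp add: power2_eq_square mult_ac)
  then have "(l * (norm (Y - (p, 0)) * norm (X - (q, 0))))\<^sup>2 = (norm (Y - (q, 0)) * norm (X - (p, 0)))\<^sup>2"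
    using c(1) l by simp
  then have "l * (norm (Y - (p, 0)) * norm (X - (q, 0))) = norm (Y - (q, 0)) * norm (X - (p, 0))"
    by (rule power2_eq_imp_eq) (use l in auto)
  then show "norm (Y - (p, 0)) * norm (X - (q, 0)) = (1 / l) * norm (Y - (q, 0)) * norm (X - (p, 0))"
    using l by (simp add: field_simps)
  show "Y \<noteq> (q, 0)" if "X \<noteq> (q, 0)" using Q that l by auto
qed

section \<open>Schottky generators\<close>

lemma vec_differentiable:
  fixes f :: "'a::real_normed_vector \<Rightarrow> real^'n"
  assumes "\<And>i. (\<lambda>x. f x $ i) differentiable (at x)"
  shows "f differentiable (at x)"
proof -
  have "(\<lambda>x. f x \<bullet> b) differentiable (at x)" if "b \<in> Basis" for b
  proof -
    obtain i where "b = axis i 1" using \<open>b \<in> Basis\<close> by (auto simp: Basis_vec_def)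
    then show ?thesis using assms[of i] by (simp add: inner_axis)
  qed
  then show ?thesis using differentiable_componentwise_within by blast
qed

lemma word_orthochronous:
  assumes "g a \<in> orthochronous"
  shows "word g (\<lambda>_. a) n \<in> orthochronous"
  by (induction n) (use assms in \<open>auto intro: orthochronous_mult\<close>)

text \<open>One generator with its inverse M. K stands for the ball whose exterior is mapped onto
  the open ball, and the last two assumptions unfold hyperbolicity.\<close>

locale schottky_generator =
  fixes A M :: "real^('m::finite option option)^('m option option)" and K :: "(real^'m) set"
    and c :: "real^'m" and r :: real
  assumes A: "A \<in> orthochronous" and AM: "A ** M = mat 1" and MA: "M ** A = mat 1"
    and r: "r > 0" and K: "compact K" "K \<noteq> {}" "K \<inter> cball c r = {}"
    and act_ext: "act_SO A ` (boundary - bdry ` K) = bdry ` interior (cball c r)"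
    and no_interior_fixed_point: "\<And>z t. t > 0 \<Longrightarrow> act_SO A (Some (z, t)) \<noteq> Some (z, t)"
    and two_fixed_points: "card {p \<in> boundary. act_SO A p = p} = 2"
begin

abbreviation "B \<equiv> ball c r"

text \<open>Meaningful off K, where the image is a finite boundary point.\<close>

definition \<phi> where "\<phi> x = fst (the (act_SO A (bdry x)))"

lemma M: "M \<in> orthochronous"
  by (rule orthochronous_inverse[OF A AM])

lemma act_inverse:
  assumes "p \<in> closed_half_space"
  shows "act_SO A (act_SO M p) = p" "act_SO M (act_SO A p) = p"
  using act_SO_mult[OF A M assms] act_SO_mult[OF M A assms] assms
  by (simp_all add: AM MA act_SO_mat_1)

lemma act_boundary_notin_K:
  assumes "p \<in> boundary" "p \<notin> bdry ` K"
  shows "act_SO A p \<in> bdry ` B"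
  using act_ext assms by auto

lemma act_notin_K:
  assumes "x \<notin> K"
  shows "act_SO A (bdry x) = bdry (\<phi> x)" "\<phi> x \<in> B"
proof -
  have "bdry x \<in> boundary" "bdry x \<notin> bdry ` K" using assms by (auto simp: boundary_def bdry_def)
  from act_boundary_notin_K[OF this] obtain y where "act_SO A (bdry x) = bdry y" "y \<in> B" by blast
  moreover from this have "\<phi> x = y" by (simp add: \<phi>_def bdry_def)
  ultimately show "act_SO A (bdry x) = bdry (\<phi> x)" "\<phi> x \<in> B" by auto
qed

lemma ball_disjoint: "x \<in> B \<Longrightarrow> x \<notin> K" "x \<in> cball c r \<Longrightarrow> x \<notin> K"
  using K(3) by auto

text \<open>A fixed point outside K lies in B, so neither one is \<infinity>. That p is in B and q
  in K follows from the dynamics: orbits in B converge to p, and the compact set K leaves no room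
  for q outside it.\<close>

lemma fixed_points:
  obtains p q l where "p \<in> B" "q \<in> K" "l > 1"
    "A *v cone_vector (bdry p) = l *\<^sub>R cone_vector (bdry p)"
    "A *v cone_vector (bdry q) = (1 / l) *\<^sub>R cone_vector (bdry q)"
proof -
  have fin: "\<exists>x. p = bdry x \<and> (x \<in> K \<or> x \<in> B)" if "p \<in> boundary" "act_SO A p = p" for p
    using act_boundary_notin_K[OF that(1)] unfolding that(2) by blast
  obtain P1 P2 where P: "P1 \<noteq> P2" "{p \<in> boundary. act_SO A p = p} = {P1, P2}"
    using two_fixed_points by (auto simp: card_2_iff)
  then have "P1 \<in> boundary \<and> act_SO A P1 = P1" "P2 \<in> boundary \<and> act_SO A P2 = P2" by blast+
  then obtain x1 x2 where x: "act_SO A (bdry x1) = bdry x1" "act_SO A (bdry x2) = bdry x2"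
      "P1 = bdry x1" "P2 = bdry x2" "x1 \<in> K \<or> x1 \<in> B" "x2 \<in> K \<or> x2 \<in> B"
    using fin by metis
  have "x1 \<noteq> x2" using P x by auto
  from hyperbolic_eigenvectors[OF A x(1,2) this no_interior_fixed_point]
  obtain p q l where pq: "{p, q} = {x1, x2}" "p \<noteq> q" and l: "l > 1"
    and pv: "A *v cone_vector (bdry p) = l *\<^sub>R cone_vector (bdry p)"
    and qv: "A *v cone_vector (bdry q) = (1 / l) *\<^sub>R cone_vector (bdry q)"
    by blast
  have pq': "p \<in> K \<or> p \<in> B" "q \<in> K \<or> q \<in> B" using pq x(5,6) by (auto simp: doubleton_eq_iff)
  have l0: "l > 0" using l by simp
  have ratio: "norm (y - p) * norm (x - q) = (1 / l) * norm (y - q) * norm (x - p)"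
    "x \<noteq> q \<Longrightarrow> y \<noteq> q"
    if "act_SO A (bdry x) = bdry y" for x y
    using act_SO_ratio_contraction[OF A l0 pv qv, of "(x, 0)" "(y, 0)"] that
    by (simp_all add: bdry_def)
  have "p \<in> B"
  proof -
    \<comment> \<open>At this stage q might still lie in B, and the orbit must not start
      there.\<close>
    have "infinite B" using uncountable_ball[OF r] countable_finite by blast
    then have "infinite (B - {q})" by simp
    then have "B - {q} \<noteq> {}" by (metis finite.emptyI)
    then obtain x0 where x0: "x0 \<in> B" "x0 \<noteq> q" by blast
    define y where "y n = (\<phi> ^^ n) x0" for n
    have yB: "y n \<in> B" for n by (induction n) (use x0 act_notin_K(2)[OF ball_disjoint(1)] in \<open>simp_all add: y_def del: mem_ball\<close>)
    have step: "act_SO A (bdry (y n)) = bdry (y (Suc n))" for n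
      using act_notin_K(1)[OF ball_disjoint(1)[OF yB]] by (simp add: y_def)
    have yq: "y n \<noteq> q" for n
      by (induction n) (use x0 ratio(2)[OF step] in \<open>auto simp: y_def\<close>)
    have "y \<longlonglongrightarrow> p"
    proof (rule tendsto_of_ratio_contraction[where q = q and \<kappa> = "1 / l"])
      show "norm (y (Suc n) - p) * norm (y n - q) = 1 / l * norm (y (Suc n) - q) * norm (y n - p)" for n
        by (rule ratio(1)[OF step])
    qed (use l pq(2) yq in auto)
    moreover have "\<forall>n. y n \<in> cball c r" using yB by (simp add: less_imp_le)
    ultimately have "p \<in> cball c r" using closed_sequentially[OF closed_cball] by blast
    then show ?thesis using pq'(1) ball_disjoint by blast
  qed
  moreover have "q \<in> K"
  proof (rule ccontr)
    assume qK: "q \<notin> K"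
    \<comment> \<open>Maximise |x - p| / |x - q| over K. The preimage under A of the maximising
      point is again in K, since everything else is mapped into B, and its ratio is larger by the
      factor l > 1.\<close>
    have "continuous_on K (\<lambda>x. norm (x - p) / norm (x - q))"
      using qK by (intro continuous_intros) auto
    from continuous_attains_sup[OF K(1,2) this] obtain y where
      y: "y \<in> K" "\<And>x. x \<in> K \<Longrightarrow> norm (x - p) / norm (x - q) \<le> norm (y - p) / norm (y - q)" by blast
    have ym: "act_SO A (act_SO M (bdry y)) = bdry y" by (rule act_inverse) simp
    have "bdry y \<notin> bdry ` B" using y(1) ball_disjoint(1)[of y] by (auto simp: bdry_def)
    moreover have "act_SO M (bdry y) \<in> boundary"
      by (rule act_SO_boundary[OF M]) (simp add: boundary_def)
    ultimately obtain x where x: "act_SO M (bdry y) = bdry x" "x \<in> K"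
      using act_boundary_notin_K[of "act_SO M (bdry y)"] ym by auto
    have "p \<notin> K" using \<open>p \<in> B\<close> ball_disjoint by blast
    then have nz: "norm (x - q) > 0" "norm (y - q) > 0" "norm (y - p) > 0" using x(2) y(1) qK by auto
    have "norm (y - p) * norm (x - q) = (1 / l) * norm (y - q) * norm (x - p)"
      using ratio(1)[of x y] ym x(1) by simp
    then have "norm (x - p) / norm (x - q) = l * (norm (y - p) / norm (y - q))"
      using nz l0 by (simp add: field_simps)
    moreover have "\<dots> > 1 * (norm (y - p) / norm (y - q))"
      using l nz by (intro mult_strict_right_mono) auto
    ultimately show False using y(2)[OF x(2)] by simp
  qed
  ultimately show thesis using that l pv qv by blast
qed

text \<open>U is left as a parameter between B and the complement of K, so that it can be enlarged
  to contain the attracting point of another generator. Stability is automatic, as everything off K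
  is sent into B.\<close>

lemma attracting_generator:
  fixes g :: "nat \<Rightarrow> real^('m option option)^('m option option)" and D :: "nat \<Rightarrow> (real^'m) set"
  assumes U: "open U" "U \<inter> K = {}" "B \<subseteq> U"
    and a: "a \<in> {1..N}" "\<And>j. j \<in> {1..N} \<Longrightarrow> j \<noteq> a \<Longrightarrow> D j \<inter> D a = {}" "D a = cball c r"
    and ga: "g a = A" "matrix_inv (g a) = M"
  obtains p q \<kappa> C x where
    "attracting_generator act_SO g D N a U p q \<phi> \<kappa> C" "p \<in> B" "q \<in> K"
    "\<forall>n. act_SO (word g (\<lambda>_. a) n) base_pt = Some (x n) \<and> snd (x n) \<noteq> 0" "x \<longlonglongrightarrow> (p, 0)"
proof -
  obtain p q l where p: "p \<in> B" and q: "q \<in> K" and l: "l > 1"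
    and pv: "A *v cone_vector (bdry p) = l *\<^sub>R cone_vector (bdry p)"
    and qv: "A *v cone_vector (bdry q) = (1 / l) *\<^sub>R cone_vector (bdry q)"
    by (rule fixed_points)
  have l0: "l > 0" using l by simp
  have pq: "p \<noteq> q" using p q ball_disjoint by blast
  have UK: "x \<notin> K" if "x \<in> U" for x using U(2) that by blast
  have ratio: "norm (y - p) * norm (x - q) = (1 / l) * norm (y - q) * norm (x - p)"
    if "act_SO A (bdry x) = bdry y" for x y
    using act_SO_ratio_contraction(1)[OF A l0 pv qv, of "(x, 0)" "(y, 0)"] that
    by (simp add: bdry_def)
  \<comment> \<open>The inverse branch in homogeneous form: \<open>w z\<close> represents the image
    of z under M, and \<open>s z = 0\<close> means that this image is \<infinity>. Otherwise
    \<open>w z\<close> is s/2 times a normalised cone vector, whence the conformal factor m = 2 /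
    s.\<close>
  define w where "w z = M *v cone_vector (bdry z)" for z
  define s where "s z = w z $ Some None + w z $ None" for z
  define m where "m z = 2 / s z" for z
  define \<psi> where "\<psi> z = (\<chi> j. w z $ Some (Some j) / s z)" for z
  have Mw: "act_SO M (bdry z) = bdry (\<psi> z)" "s z > 0" "w z = (s z / 2) *\<^sub>R cone_vector (bdry (\<psi> z))"
    if sz: "s z \<noteq> 0" for z
  proof -
    have wf: "w z \<in> future_cone"
      unfolding w_def by (intro orthochronous_future M cone_vector_future) simp
    have "quad_form (w z) = 0"
      unfolding w_def orthochronousD(1)[OF M] by (simp add: bdry_def quad_form_cone_vector)
    then have cp: "cone_point (w z) = bdry (\<psi> z)"
      using sz by (simp add: cone_point_def Let_def bdry_def \<psi>_def s_def)
    then show "act_SO M (bdry z) = bdry (\<psi> z)" by (simp add: act_SO_def w_def)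
    from future_cone_decomposition(2)[OF wf] obtain b where
      b: "b > 0" "w z = b *\<^sub>R cone_vector (cone_point (w z))" "s z \<noteq> 0 \<longrightarrow> b = s z / 2"
      unfolding s_def by blast
    then show "s z > 0" "w z = (s z / 2) *\<^sub>R cone_vector (bdry (\<psi> z))" using sz cp by auto
  qed
  have conf: "(norm (\<psi> z - \<psi> y))\<^sup>2 = m z * m y * (norm (z - y))\<^sup>2" if "s z \<noteq> 0" "s y \<noteq> 0" for z y
  proof -
    have f: "lorentz_form (cone_vector (bdry u)) (cone_vector (bdry v)) = - 2 * (norm (u - v))\<^sup>2" for u v :: "real^'m"
      using lorentz_form_cone_vector[of u 0 v] by (simp add: bdry_def norm_Pair)
    have "lorentz_form (w z) (w y) = - 2 * (norm (z - y))\<^sup>2"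
      unfolding w_def orthochronousD(2)[OF M] f ..
    moreover have "lorentz_form (w z) (w y) = (s z / 2) * (s y / 2) * (- 2 * (norm (\<psi> z - \<psi> y))\<^sup>2)"
      unfolding Mw(3)[OF that(1)] Mw(3)[OF that(2)] by (simp add: f)
    ultimately show ?thesis using that by (simp add: m_def field_simps)
  qed
  have comp: "(\<lambda>z. w z $ i) differentiable (at z)" for i z
  proof -
    have "(\<lambda>z :: real^'m. cone_vector (bdry z) $ k) differentiable (at z)" for k
    proof -
      consider "k = None" | "k = Some None" | j where "k = Some (Some j)" by (metis option.exhaust)
      then show ?thesis
        by cases (auto simp: bdry_def power2_norm_eq_inner intro!: derivative_intros
            bounded_linear_imp_differentiable bounded_linear_vec_nth
            bounded_linear_intros)
    qed
    then show ?thesis unfolding w_def matrix_vector_mult_def by (auto intro!: derivative_intros)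
  qed
  have cont_s: "isCont s z" for z
    unfolding s_def[abs_def] by (intro continuous_intros differentiable_imp_continuous_within comp)
  have diff: "\<psi> differentiable (at z)" if "s z \<noteq> 0" for z
  proof (rule vec_differentiable)
    have "s differentiable (at z)" unfolding s_def[abs_def] by (intro derivative_intros comp)
    then show "(\<lambda>z. \<psi> z $ i) differentiable (at z)" for i
      using that unfolding \<psi>_def by (auto intro!: derivative_intros comp)
  qed
  have \<psi>\<phi>: "s (\<phi> z) \<noteq> 0" "\<psi> (\<phi> z) = z" if "z \<in> U" for z
  proof -
    have Mz: "act_SO M (bdry (\<phi> z)) = bdry z"
      using act_inverse(2)[of "bdry z"] act_notin_K(1)[OF UK[OF that]] by simp
    then have "cone_point (w (\<phi> z)) \<noteq> None" by (simp add: act_SO_def w_def bdry_def)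
    then show s0: "s (\<phi> z) \<noteq> 0" by (auto simp: cone_point_def s_def)
    show "\<psi> (\<phi> z) = z" using Mw(1)[OF s0] Mz by (simp add: bdry_def)
  qed
  \<comment> \<open>The two-point identity for \<psi> with second point q: here \<psi> q = q, and m
    q = 1 / l because M multiplies the eigenvector at q by l.\<close>
  have mq: "m (\<phi> z) = l * (norm (z - q) / norm (\<phi> z - q))\<^sup>2" if zU: "z \<in> U" for z
  proof -
    have "M *v (A *v cone_vector (bdry q)) = (1 / l) *\<^sub>R (M *v cone_vector (bdry q))"
      unfolding qv by (simp only: matrix_vector_mult_scaleR)
    then have "cone_vector (bdry q) = (1 / l) *\<^sub>R w q"
      by (simp add: matrix_vector_mul_assoc MA w_def)
    then have wq: "w q = l *\<^sub>R cone_vector (bdry q)" using l0 by simp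
    have sq: "s q = 2 * l" unfolding s_def wq by (simp add: bdry_def algebra_simps)
    have "cone_point (w q) = bdry q"
      unfolding wq cone_point_scaleR[OF l0] by (simp add: cone_point_cone_vector)
    then have "\<psi> q = q" using Mw(1)[of q] sq l0 by (simp add: act_SO_def w_def bdry_def)
    then have "(norm (z - q))\<^sup>2 = m (\<phi> z) * (1 / l) * (norm (\<phi> z - q))\<^sup>2"
      using conf[OF \<psi>\<phi>(1)[OF zU], of q] sq l0 \<psi>\<phi>(2)[OF zU] by (simp add: m_def)
    moreover have "\<phi> z \<noteq> q" using act_notin_K(2)[OF UK[OF zU]] q ball_disjoint by blast
    ultimately show ?thesis using l0 by (simp add: power_divide field_simps)
  qed
  have dist: "distortion act_SO g D N (bdry (\<phi> z))
      = ln (l * (norm (z - q) / norm (\<phi> z - q))\<^sup>2 * (1 + (norm (\<phi> z))\<^sup>2) / (1 + (norm z)\<^sup>2))"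
    if zU: "z \<in> U" for z
  proof -
    note s0 = \<psi>\<phi>(1)[OF zU]
    have ev: "\<forall>\<^sub>F v in nhds (\<phi> z). s v \<noteq> 0"
      using cont_s[of "\<phi> z"] s0 by (metis continuous_at tendsto_imp_eventually_ne tendsto_at_iff_tendsto_nhds)
    have "distortion act_SO g D N (bdry (\<phi> z))
        = ln (m (\<phi> z) * (1 + (norm (\<phi> z))\<^sup>2) / (1 + (norm (\<psi> (\<phi> z)))\<^sup>2))"
    proof (rule distortion_of_inverse_branch[where g = g and a = a and D = D, OF a(1,2)])
      show "\<phi> z \<in> interior (D a)" using act_notin_K(2)[OF UK[OF zU]] a(3) by simp
      show "\<forall>\<^sub>F v in nhds (\<phi> z). act_SO (matrix_inv (g a)) (bdry v) = bdry (\<psi> v)"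
        using ev unfolding ga(2) by eventually_elim (rule Mw(1))
      show "\<psi> differentiable (at (\<phi> z))" by (rule diff[OF s0])
      show "isCont m (\<phi> z)" unfolding m_def[abs_def] using s0 by (intro continuous_intros cont_s) auto
      show "m (\<phi> z) > 0" using Mw(2)[OF s0] by (simp add: m_def)
      show "\<forall>\<^sub>F v in nhds (\<phi> z). (norm (\<psi> v - \<psi> (\<phi> z)))\<^sup>2 = m v * m (\<phi> z) * (norm (v - \<phi> z))\<^sup>2"
        using ev by eventually_elim (rule conf[OF _ s0])
    qed
    then show ?thesis by (simp add: \<psi>\<phi>(2)[OF zU] mq[OF zU])
  qed
  have word: "word g (\<lambda>_. a) n \<in> orthochronous" for n
    by (rule word_orthochronous) (simp add: ga A)
  have "attracting_generator act_SO g D N a U p q \<phi> (1 / l) l"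
  proof
    show "q \<notin> U" using q U(2) by blast
    fix z assume zU: "z \<in> U"
    note act = act_notin_K[OF UK[OF zU]]
    show "\<phi> z \<in> U" using act(2) U(3) by blast
    show "norm (\<phi> z - p) * norm (z - q) = 1 / l * norm (\<phi> z - q) * norm (z - p)"
      by (rule ratio[OF act(1)])
    show "act_SO (word g (\<lambda>_. a) j) (bdry z) = bdry ((\<phi> ^^ Suc j) z)" for j
    proof (induction j)
      case (Suc j)
      have "(\<phi> ^^ Suc j) z \<in> B"
        by (induction j) (use act(2) act_notin_K(2)[OF ball_disjoint(1)] in \<open>simp_all del: mem_ball\<close>)
      then show ?case
        using act_notin_K(1)[OF ball_disjoint(1)] by (simp add: ga act_SO_mult[OF A word] Suc[simplified])
    qed (simp add: ga act(1))
  qed (use l U(1) pq dist in auto)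
  moreover obtain x where x: "\<And>n. act_SO (word g (\<lambda>_. a) n) base_pt = Some (x n)" "\<And>n. snd (x n) > 0"
  proof -
    \<comment> \<open>The form is -4 at o and is preserved, but vanishes on the boundary; hence the
      orbit keeps positive height.\<close>
    have "\<exists>X. act_SO W base_pt = Some X \<and> snd X > 0" if W: "W \<in> orthochronous" for W :: "real^('m option option)^('m option option)"
    proof -
      have o: "(base_pt :: (real^'m) hpt) \<in> closed_half_space"
        by (simp add: base_pt_def closed_half_space_def)
      obtain b where b: "b > 0" "W *v cone_vector base_pt = b *\<^sub>R cone_vector (act_SO W base_pt)"
        by (rule cone_vector_act_SO[OF W o])
      have "b\<^sup>2 * quad_form (cone_vector (act_SO W base_pt)) = - 4"
        using orthochronousD(1)[OF W, of "cone_vector base_pt"] b(2)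
        by (simp add: quad_form_scaleR base_pt_def quad_form_cone_vector)
      then have "act_SO W base_pt \<notin> boundary"
        using quad_form_cone_vector_boundary[of "act_SO W base_pt"] by auto
      then show ?thesis
        using act_SO_closed_half_space[OF W o] by (force simp: boundary_def bdry_def closed_half_space_def image_iff)
    qed
    from this[OF word] have "\<exists>x. \<forall>n. act_SO (word g (\<lambda>_. a) n) base_pt = Some (x n) \<and> snd (x n) > 0"
      by (intro choice allI)
    then show thesis using that by blast
  qed
  moreover have "x \<longlonglongrightarrow> (p, 0)"
  proof (rule tendsto_of_ratio_contraction[where q = "(q, 0)" and \<kappa> = "1 / l"])
    fix n
    have "act_SO A (Some (x n)) = Some (x (Suc n))"
    proof -
      have o: "(base_pt :: (real^'m) hpt) \<in> closed_half_space"
        by (simp add: base_pt_def closed_half_space_def)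
      show ?thesis
        using act_SO_mult[OF A word o, of n] x(1)[of n] x(1)[of "Suc n"] by (simp add: ga)
    qed
    then show "norm (x (Suc n) - (p, 0)) * norm (x n - (q, 0))
        = 1 / l * norm (x (Suc n) - (q, 0)) * norm (x n - (p, 0))"
      by (rule act_SO_ratio_contraction(1)[OF A l0 pv qv less_imp_le[OF x(2)]])
    show "x n \<noteq> (q, 0)" using x(2)[of n] by auto
  qed (use l pq in auto)
  moreover have "\<forall>n. act_SO (word g (\<lambda>_. a) n) base_pt = Some (x n) \<and> snd (x n) \<noteq> 0"
    using x by (simp add: less_imp_neq[THEN not_sym])
  ultimately show thesis using p q by (intro that)
qed

end

section \<open>Choice of two Schottky generators\<close>

text \<open>For N_0 = 1 every generator is \<open>g 1\<close> or its inverse, and the semigroup is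
  commutative.\<close>

lemma schottky_two_le:
  fixes g :: "nat \<Rightarrow> real^('m::finite option option)^('m option option)"
  assumes S: "schottky_setting N\<^sub>0 N\<^sub>1 g D"
  shows "N\<^sub>0 \<ge> 2"
proof (rule ccontr)
  assume "\<not> ?thesis"
  then have N0: "N\<^sub>0 = 1" "N\<^sub>1 \<le> 1" using S by (auto simp: schottky_setting_def)
  let ?S = "g ` {1..N\<^sub>0 + N\<^sub>1}"
  have z: "zariski_dense_in (semigroup_generated ?S) SO_Q_identity_component"
    using S by (simp add: schottky_setting_def)
  have "1 \<in> {1..N\<^sub>0 + N\<^sub>1}" using N0 by simp
  then have "g 1 \<in> SO_Q_identity_component"
    using S unfolding schottky_setting_def hyperbolic_element_def by blast
  then have "g 1 \<in> SO_Q"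
    unfolding SO_Q_identity_component_def using connected_component_subset by blast
  then have "det (g 1) \<noteq> 0" by (simp add: SO_Q_def)
  note inv = matrix_inv_inverse[OF this]
  have g2: "g i = g 1 \<or> g i = matrix_inv (g 1)" if i: "i \<in> {1..N\<^sub>0 + N\<^sub>1}" for i
  proof (cases "i = 1")
    case False
    then have "i = N\<^sub>0 + 1" "1 \<in> {1..N\<^sub>1}" using i N0 by auto
    then show ?thesis using S unfolding schottky_setting_def by blast
  qed simp
  have "X ** Y = Y ** X" if "X \<in> SO_Q_identity_component" "Y \<in> SO_Q_identity_component"
    for X Y :: "real^('m option option)^('m option option)"
  proof (rule zariski_dense_in_commute[OF z _ that], rule semigroup_generated_commute)
    fix X Y assume "X \<in> ?S" "Y \<in> ?S"
    then obtain i j where "i \<in> {1..N\<^sub>0 + N\<^sub>1}" "X = g i" "j \<in> {1..N\<^sub>0 + N\<^sub>1}" "Y = g j" by blast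
    with g2[of i] g2[of j] show "X ** Y = Y ** X" using inv by metis
  qed
  then show False using SO_Q_identity_component_not_commutative[where 'm = 'm] by blast
qed

lemma schottky_generator:
  fixes g :: "nat \<Rightarrow> real^('m::finite option option)^('m option option)"
  assumes S: "schottky_setting N\<^sub>0 N\<^sub>1 g D" and j: "j \<in> {1..N\<^sub>0}"
  obtains c r where "D j = cball c r" "schottky_generator (g j) (matrix_inv (g j)) (D (j + N\<^sub>0)) c r"
proof -
  have j': "j \<in> {1..2 * N\<^sub>0}" "j + N\<^sub>0 \<in> {1..2 * N\<^sub>0}" "j \<in> {1..N\<^sub>0 + N\<^sub>1}" using j by auto
  have balls: "\<forall>j\<in>{1..2 * N\<^sub>0}. \<exists>c r. r > 0 \<and> D j = cball c r"
    and disj: "disjoint_family_on D {1..2 * N\<^sub>0}"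
    and hyp: "\<forall>j\<in>{1..N\<^sub>0 + N\<^sub>1}. hyperbolic_element (g j)"
    and ext: "\<forall>j\<in>{1..N\<^sub>0}. act_SO (g j) ` (boundary - bdry ` D (j + N\<^sub>0)) = bdry ` interior (D j)"
    using S by (simp_all add: schottky_setting_def)
  obtain c r where cr: "r > 0" "D j = cball c r" using bspec[OF balls j'(1)] by blast
  obtain c' r' where cr': "r' > 0" "D (j + N\<^sub>0) = cball c' r'" using bspec[OF balls j'(2)] by blast
  have h: "hyperbolic_element (g j)" using bspec[OF hyp j'(3)] .
  then have gj: "g j \<in> SO_Q_identity_component" by (simp add: hyperbolic_element_def)
  have "det (g j) \<noteq> 0"
    using subsetD[OF connected_component_subset gj[unfolded SO_Q_identity_component_def]]
    by (simp add: SO_Q_def)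
  note inv = matrix_inv_inverse[OF this]
  have "D (j + N\<^sub>0) \<inter> D j = {}"
    using disj j' j unfolding disjoint_family_on_def by auto
  then have "schottky_generator (g j) (matrix_inv (g j)) (D (j + N\<^sub>0)) c r"
    using h inv cr cr' gj SO_Q_identity_component_orthochronous bspec[OF ext j]
    by unfold_locales (auto simp: hyperbolic_element_def simp del: interior_cball)
  with cr(2) show thesis by (rule that)
qed

theorem LNIC_schottky:
  fixes g :: "nat \<Rightarrow> real^('m::finite option option)^('m option option)"
  assumes S: "schottky_setting N\<^sub>0 N\<^sub>1 g D"
  shows "LNIC act_SO g D (N\<^sub>0 + N\<^sub>1) (schottky_adm N\<^sub>0)"
proof -
  have N0: "N\<^sub>0 \<ge> 2" by (rule schottky_two_le[OF S])
  have N1: "N\<^sub>1 \<le> N\<^sub>0" using S by (simp add: schottky_setting_def)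
  have "disjoint_family_on D {1..2 * N\<^sub>0}" using S by (simp add: schottky_setting_def)
  then have disj: "D i \<inter> D j = {}" if "i \<in> {1..2 * N\<^sub>0}" "j \<in> {1..2 * N\<^sub>0}" "i \<noteq> j" for i j
    using that unfolding disjoint_family_on_def by blast
  have j: "1 \<in> {1..N\<^sub>0}" "2 \<in> {1..N\<^sub>0}" using N0 by auto
  obtain c1 r1 where 1: "D 1 = cball c1 r1" "schottky_generator (g 1) (matrix_inv (g 1)) (D (1 + N\<^sub>0)) c1 r1"
    by (rule schottky_generator[OF S j(1)])
  obtain c2 r2 where 2: "D 2 = cball c2 r2" "schottky_generator (g 2) (matrix_inv (g 2)) (D (2 + N\<^sub>0)) c2 r2"
    by (rule schottky_generator[OF S j(2)])
  interpret G1: schottky_generator "g 1" "matrix_inv (g 1)" "D (1 + N\<^sub>0)" c1 r1 by (rule 1(2))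
  interpret G2: schottky_generator "g 2" "matrix_inv (g 2)" "D (2 + N\<^sub>0)" c2 r2 by (rule 2(2))
  have d: "D j \<inter> D i = {}" if "i \<in> {1..N\<^sub>0 + N\<^sub>1}" "j \<in> {1..N\<^sub>0 + N\<^sub>1}" "j \<noteq> i" for i j
    using disj that N1 by auto
  have N: "1 \<in> {1..N\<^sub>0 + N\<^sub>1}" "2 \<in> {1..N\<^sub>0 + N\<^sub>1}" using N0 by auto
  have b: "ball c1 r1 \<subseteq> D 1" "ball c2 r2 \<subseteq> D 2" unfolding 1 2 by (rule ball_subset_cball)+
  \<comment> \<open>The second domain is the union of both open balls: it contains the attracting
    point of \<open>g 1\<close>, and \<open>g 2\<close> maps it into its own ball because it avoids
    D_{2+N_0}.\<close>
  have U: "ball c1 r1 \<inter> D (1 + N\<^sub>0) = {}" "(ball c1 r1 \<union> ball c2 r2) \<inter> D (2 + N\<^sub>0) = {}"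
    using b disj[of 1 "1 + N\<^sub>0"] disj[of 1 "2 + N\<^sub>0"] disj[of 2 "2 + N\<^sub>0"] N0 by auto
  obtain p q \<kappa> C x where a1: "attracting_generator act_SO g D (N\<^sub>0 + N\<^sub>1) 1 (ball c1 r1) p q G1.\<phi> \<kappa> C"
    "p \<in> ball c1 r1" "q \<in> D (1 + N\<^sub>0)"
    "\<forall>n. act_SO (word g (\<lambda>_. 1) n) base_pt = Some (x n) \<and> snd (x n) \<noteq> 0" "x \<longlonglongrightarrow> (p, 0)"
    by (rule G1.attracting_generator[where g = g and D = D and a = 1 and N = "N\<^sub>0 + N\<^sub>1",
        OF open_ball U(1) subset_refl N(1) d[OF N(1)] 1(1) refl refl])
  have "open (ball c1 r1 \<union> ball c2 r2)" by (intro open_Un open_ball)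
  then obtain p' q' \<kappa>' C' x' where a2: "attracting_generator act_SO g D (N\<^sub>0 + N\<^sub>1) 2
      (ball c1 r1 \<union> ball c2 r2) p' q' G2.\<phi> \<kappa>' C'" "q' \<in> D (2 + N\<^sub>0)"
    "\<forall>n. act_SO (word g (\<lambda>_. 2) n) base_pt = Some (x' n) \<and> snd (x' n) \<noteq> 0" "x' \<longlonglongrightarrow> (p', 0)"
    by (rule G2.attracting_generator[where g = g and D = D and a = 2 and N = "N\<^sub>0 + N\<^sub>1",
        OF _ U(2) Un_upper2 N(2) d[OF N(2)] 2(1) refl refl])
  have "q \<noteq> q'" using a1(3) a2(2) disj[of "1 + N\<^sub>0" "2 + N\<^sub>0"] N0 by auto
  moreover have "schottky_adm N\<^sub>0 1 1" "schottky_adm N\<^sub>0 1 2" "schottky_adm N\<^sub>0 2 2"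
    using N0 by (auto simp: schottky_adm_def)
  moreover have "p \<in> D 1" using a1(2) b by blast
  ultimately show ?thesis
    using LNIC_of_attracting_generators[OF a1(1) a2(1) N] a1(2,4,5) by simp
qed

theorem proposition11p6:
  fixes g :: "nat \<Rightarrow> real^('m::finite option option)^('m option option)"
    and D :: "nat \<Rightarrow> (real^'m) set"
    and N\<^sub>0 N\<^sub>1 :: nat
    and h :: "nat \<Rightarrow> complex^2^2"
    and E :: "nat \<Rightarrow> complex set"
    and A :: "complex set"
    and \<epsilon> :: real
  shows "(schottky_setting N\<^sub>0 N\<^sub>1 g D \<longrightarrow> LNIC act_SO g D (N\<^sub>0 + N\<^sub>1) (schottky_adm N\<^sub>0))
       \<and> (cf_setting A \<epsilon> h E \<longrightarrow> LNIC act_SL2 h E ((card A)\<^sup>2) cf_adm)"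
  using LNIC_schottky[of N\<^sub>0 N\<^sub>1 g D] cf_semigroup.LNIC[of A \<epsilon> h E]
  by (simp add: cf_semigroup_def)

end
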